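(* Let $n\ge1$. For $0\le j\le 2n-1$, $$g_n^{\mathbf b}(j)=\begin{cases}1 & \text{if } j=0,\\[2pt] \dfrac{Z_{n-1}}{Z_n} & \text{if } j=1,\\[4pt] \dfrac{Z_{n-1}}{Z_n}\left(1-g_{n-1}^{\mathbf b}(j-2)+\displaystyle\sum_{r=0}^{n-1}(-1)^r\binom{n+1}{r+2}g_{n-1}(r,j-2)\right) & \text{if } j\ge 2.\end{cases}$$
   Context: Notation: $[x]_2\in\{0,1\}$ is $x \bmod 2$. For $n\ge0$, $G_n=(\mathtt V_n,\mathtt E_n)$ is the graph with $\mathtt V_n=\{(x_1,x_2)\in\mathbb Z^2: 0\le x_1\le 2n,\ x_1\le x_2\le 2n+1\}$, with the vertex $(2n,2n+1)$ removed when $n$ is odd, and $\mathtt E_n$ consists of - the edges $\{(x_1,x_2),(x_1+1,x_2)\}$ with $0\le x_1\le 2n-1$, $x_1\le x_2\le 2n+1$, $[x_1+x_2]_2=1$; - the edges $\{(x_1,x_2),(x_1,x_2+1)\}$ with $0\le x_1\le 2n-[n]_2$, $x_1\le x_2\le 2n$; - the edges $\{(x_1,x_1),(x_1+1,x_1+1)\}$ with $0\le x_1\le 2n-1$. $Z_n$ is the number of perfect matchings of $G_n$ (it is positive), and $Z_n^{\{v_1,\dots,v_m\}}$ is the number of perfect matchings of the subgraph of $G_n$ induced on $\mathtt V_n\setminus\{v_1,\dots,v_m\}$. In quantities indexed by $n$, $\mathbf b$ denotes the vertex $(2n,2n+1-[n]_2)$ of $G_n$. For $0\le j\le 2n-1$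 let $$g_n^{\mathbf b}(j)=\frac{Z_n^{\{(j,j),\mathbf b\}}}{Z_n},$$ and for $0\le i<j\le 2n-1$ let $g_n(i,j)=Z_n^{\{(i,i),(j,j)\}}/Z_n$, with $g_n(j,i)=-g_n(i,j)$ and $g_n(i,i)=0$. (These are the absolute values, for $i<j$, of the entries $K_n^{-1}((j,j),\mathbf b)$ and $K_n^{-1}((i,i),(j,j))$ of the inverse Kasteleyn matrix.) *)

theory Defs
  imports Complex_Main
begin

type_synonym vertex = "int \<times> int"

definition vertices :: "nat \<Rightarrow> vertex set" where
  "vertices n =
     {(x1, x2). 0 \<le> x1 \<and> x1 \<le> 2 * int n \<and> x1 \<le> x2 \<and> x2 \<le> 2 * int n + 1}
     - (if odd n then {(2 * int n, 2 * int n + 1)} else {})"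

definition horizontal_edges :: "nat \<Rightarrow> vertex set set" where
  "horizontal_edges n =
     {{(x1, x2), (x1 + 1, x2)} | x1 x2.
        0 \<le> x1 \<and> x1 \<le> 2 * int n - 1 \<and> x1 \<le> x2 \<and> x2 \<le> 2 * int n + 1
        \<and> (x1 + x2) mod 2 = 1}"

definition vertical_edges :: "nat \<Rightarrow> vertex set set" where
  "vertical_edges n =
     {{(x1, x2), (x1, x2 + 1)} | x1 x2.
        0 \<le> x1 \<and> x1 \<le> 2 * int n - int n mod 2 \<and> x1 \<le> x2 \<and> x2 \<le> 2 * int n}"

definition diagonal_edges :: "nat \<Rightarrow> vertex set set" where
  "diagonal_edges n =
     {{(x1, x1), (x1 + 1, x1 + 1)} | x1. 0 \<le> x1 \<and> x1 \<le> 2 * int n - 1}"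

definition edges :: "nat \<Rightarrow> vertex set set" where
  "edges n = horizontal_edges n \<union> vertical_edges n \<union> diagonal_edges n"

definition perfect_matchings :: "'v set \<Rightarrow> 'v set set \<Rightarrow> 'v set set set" where
  "perfect_matchings V E = {M. M \<subseteq> E \<and> (\<forall>v\<in>V. \<exists>!e. e \<in> M \<and> v \<in> e)}"

definition induced_edges :: "'v set \<Rightarrow> 'v set set \<Rightarrow> 'v set set" where
  "induced_edges W E = {e \<in> E. e \<subseteq> W}"

definition Z :: "nat \<Rightarrow> nat" where
  "Z n = card (perfect_matchings (vertices n) (edges n))"

text \<open>\<open>Z_del n S\<close> is the number written $Z_n^S$: the vertices in \<open>S\<close> are removed from the
  graph, together with all edges meeting \<open>S\<close>.\<close>

definition Z_del :: "nat \<Rightarrow> vertex set \<Rightarrow> nat" where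
  "Z_del n S =
     card (perfect_matchings (vertices n - S) (induced_edges (vertices n - S) (edges n)))"

definition b_vertex :: "nat \<Rightarrow> vertex" where
  "b_vertex n = (2 * int n, 2 * int n + 1 - int n mod 2)"

text \<open>The functions below are only meaningful for indices in the range \<open>0, \<dots>, 2n - 1\<close>.\<close>

definition g_b :: "nat \<Rightarrow> nat \<Rightarrow> real" where
  "g_b n j = real (Z_del n {(int j, int j), b_vertex n}) / real (Z n)"

definition g :: "nat \<Rightarrow> nat \<Rightarrow> nat \<Rightarrow> real" where
  "g n i j =
     (if i < j then real (Z_del n {(int i, int i), (int j, int j)}) / real (Z n)
      else if j < i then - (real (Z_del n {(int j, int j), (int i, int i)}) / real (Z n))
      else 0)"

end

theory Submission
  imports Defs
begin

text \<open>
  The graph \<open>G\<^sub>n\<close> is grown from the top towards the diagonal. At each stage the numbers of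
  perfect matchings of the part already built, with a set \<open>S\<close> of lowest vertices of columns
  removed, are read as the values of an alternating form: a function on finite sets of column
  numbers stands for the form whose value on the basis vectors \<open>e\<^sub>x\<close>, \<open>x \<in> S\<close>, in increasing
  order is the value at \<open>S\<close>. Each elementary growth step is a familiar operation on forms. Two new
  vertices under column \<open>k\<close> act as the substitution \<open>e\<^sub>k \<mapsto> e\<^sub>k + e\<^bsub>k+1\<^esub>\<close> (\<open>removal_form_hop\<close>), an
  isolated new vertex wedges a basis covector on the right (\<open>removal_form_append\<close>), and the
  diagonal edge between columns \<open>k\<close> and \<open>k + 1\<close> adds the double contraction with \<open>e\<^sub>k\<close> and
  \<open>e\<^bsub>k+1\<^esub>\<close> (\<open>removal_form_pair_up\<close>). Substitutions respect wedge products, so before the diagonal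
  edges are added the form is a wedge of covectors \<open>v\<^sub>0 \<and> \<dots> \<and> v\<^bsub>m-1\<^esub>\<close>, where
  \<open>v\<^sub>j(x) = (n+1+j-x choose n-j)\<close> counts lattice paths (\<open>start_form\<close>). This is the
  Lindstroem--Gessel--Viennot description by nonintersecting paths, with the signs absorbed by the
  calculus of forms. The number \<open>m\<close> of covectors is \<open>n\<close> or \<open>n + 1\<close>: the even one of the two
  belongs to \<open>Z\<^sub>n\<close> and \<open>g\<^sub>n\<close>, the odd one to \<open>g\<^sub>n\<^sup>b\<close>, since removing \<open>b\<close> turns one into the other.

  Adding the diagonal edges nearly commutes with wedging a covector \<open>v\<close>; the defect is contraction
  with the vector \<open>\<Sum>\<^sub>k v(k) e\<^bsub>k+1\<^esub> - v(k+1) e\<^sub>k\<close> (\<open>pair_range_wedge\<close>). The theorem follows from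
  three properties of the covectors.

  First, \<open>v\<^sub>0\<close> is \<open>n + 1\<close> at \<open>0\<close>, \<open>1\<close> at \<open>1\<close> and zero afterwards, while \<open>v\<^sub>1, v\<^sub>2, \<dots>\<close> restricted to
  the columns from \<open>2\<close> on are the covectors of \<open>G\<^bsub>n-1\<^esub>\<close>. Splitting off \<open>v\<^sub>0\<close> therefore leads from
  \<open>n\<close> to \<open>n - 1\<close>, and its defect vector is \<open>(n+1) e\<^sub>1 + e\<^sub>2 - e\<^sub>0\<close> (\<open>paired_form_first\<close>). For \<open>j = 1\<close>
  this already gives \<open>Z\<^bsub>n-1\<^esub>\<close>.

  Second, \<open>v\<^sub>j\<close> is a polynomial of degree at most \<open>n\<close> on \<open>{0..n+1}\<close>, so every \<open>v\<^sub>j\<close> is annihilated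
  by the difference vector \<open>\<Sum>\<^sub>x (-1)\<^sup>x (n+1 choose x) e\<^sub>x\<close> (\<open>path_covector_relation\<close>). This
  trades \<open>(n+1) e\<^sub>1 - e\<^sub>0\<close> for the vector \<open>\<Sum>\<^sub>r (-1)\<^sup>r (n+1 choose r+2) e\<^bsub>r+2\<^esub>\<close>, which accounts for the
  binomial sum in the theorem; the remaining \<open>e\<^sub>2\<close> contributes \<open>g\<^bsub>n-1\<^esub>(0, j-2)\<close>.

  Third, \<open>v\<^sub>n\<close> is identically \<open>1\<close>, so that its defect vector telescopes to \<open>e\<^bsub>2n\<^esub> - e\<^sub>0\<close>, of which
  \<open>e\<^bsub>2n\<^esub>\<close> is annihilated by the other covectors. Splitting off \<open>v\<^sub>n\<close> gives
  \<open>g\<^sub>n(0, j) + g\<^sub>n\<^sup>b(j) = 1\<close> (\<open>g_corner_relation\<close>). This is the case \<open>j = 0\<close>, and for \<open>j \<ge> 2\<close> it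
  rewrites \<open>g\<^bsub>n-1\<^esub>(0, j-2)\<close> as \<open>1 - g\<^bsub>n-1\<^esub>\<^sup>b(j-2)\<close>.
\<close>

section \<open>Alternating forms as functions on finite sets\<close>

type_synonym form = "nat set \<Rightarrow> real"

text \<open>The sign of moving \<open>e\<^sub>x\<close> from the front to its place among the basis vectors of \<open>S\<close>. It
  counts smaller elements because these are finitely many in any set of naturals; the identities
  below then hold at every set, and equality of forms is equality of functions.\<close>

definition rank_sign :: "nat \<Rightarrow> nat set \<Rightarrow> real" where
  "rank_sign x S = (-1) ^ card {y \<in> S. y < x}"

text \<open>\<open>contract x\<close> inserts \<open>e\<^sub>x\<close> as the first argument of a form, and \<open>basis_wedge x\<close> multiplies a
  form on the left by the dual covector of \<open>e\<^sub>x\<close>.\<close>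

definition contract :: "nat \<Rightarrow> form \<Rightarrow> form" where
  "contract x \<phi> S = (if x \<in> S then 0 else rank_sign x S * \<phi> (insert x S))"

definition basis_wedge :: "nat \<Rightarrow> form \<Rightarrow> form" where
  "basis_wedge x \<phi> S = (if x \<in> S then rank_sign x S * \<phi> (S - {x}) else 0)"

text \<open>The covector is cut off at \<open>N\<close>, so that the sum stays finite at infinite sets \<open>S\<close> too and the
  antiderivation rule \<open>contract_wedge\<close> holds there.\<close>

definition wedge :: "nat \<Rightarrow> (nat \<Rightarrow> real) \<Rightarrow> form \<Rightarrow> form" where
  "wedge N v \<phi> S = (\<Sum>x\<le>N. v x * basis_wedge x \<phi> S)"

definition unit_form :: form where
  "unit_form S = (if S = {} then 1 else 0)"

lemma rank_sign_insert:
  assumes "y \<notin> S"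
  shows "rank_sign x (insert y S) = (if y < x then - rank_sign x S else rank_sign x S)"
proof -
  have "{z \<in> insert y S. z < x} =
      (if y < x then insert y {z \<in> S. z < x} else {z \<in> S. z < x})"
    by auto
  then show ?thesis
    using assms by (simp add: rank_sign_def)
qed

lemma rank_sign_remove:
  assumes "y \<in> S"
  shows "rank_sign x (S - {y}) = (if y < x then - rank_sign x S else rank_sign x S)"
  using rank_sign_insert[of y "S - {y}" x] assms by (auto simp: insert_absorb split: if_splits)

lemma rank_sign_square [simp]: "rank_sign x S * rank_sign x S = 1"
  "rank_sign x S * (rank_sign x S * r) = r"
  by (simp_all add: rank_sign_def flip: power_add mult.assoc mult_2)

lemma rank_sign_empty [simp]: "rank_sign x {} = 1"
  by (simp add: rank_sign_def)

lemma contract_contract: "contract x (contract y \<phi>) = (\<lambda>S. - contract y (contract x \<phi>) S)"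
  by (cases x y rule: linorder_cases)
    (auto simp: fun_eq_iff contract_def rank_sign_insert insert_commute)

lemma contract_twice [simp]: "contract x (contract x \<phi>) = (\<lambda>S. 0)"
  by (auto simp: fun_eq_iff contract_def)

lemma basis_wedge_basis_wedge:
  "basis_wedge x (basis_wedge y \<phi>) = (\<lambda>S. - basis_wedge y (basis_wedge x \<phi>) S)"
proof
  fix S
  have "S - {x} - {y} = S - {y} - {x}" by auto
  then show "basis_wedge x (basis_wedge y \<phi>) S = - basis_wedge y (basis_wedge x \<phi>) S"
    by (cases x y rule: linorder_cases) (auto simp: basis_wedge_def rank_sign_remove)
qed

text \<open>The canonical anticommutation relation between contracting and wedging. Together with the
  anticommutativity of contractions and of wedges it is the only source of signs below.\<close>

lemma contract_basis_wedge:
  "contract x (basis_wedge y \<phi>) S = (if x = y then \<phi> S else 0) - basis_wedge y (contract x \<phi>) S"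
proof (cases "x = y")
  case True
  then show ?thesis
    by (auto simp: contract_def basis_wedge_def rank_sign_insert rank_sign_remove insert_absorb)
next
  case False
  then have "insert x S - {y} = insert x (S - {y})" by auto
  then show ?thesis using False
    by (cases x y rule: linorder_cases)
      (auto simp: contract_def basis_wedge_def rank_sign_insert rank_sign_remove)
qed

lemma form_linear:
  "contract x (\<lambda>S. \<phi> S + \<psi> S) = (\<lambda>S. contract x \<phi> S + contract x \<psi> S)"
  "contract x (\<lambda>S. \<phi> S - \<psi> S) = (\<lambda>S. contract x \<phi> S - contract x \<psi> S)"
  "contract x (\<lambda>S. - \<phi> S) = (\<lambda>S. - contract x \<phi> S)"
  "contract x (\<lambda>S. r * \<phi> S) = (\<lambda>S. r * contract x \<phi> S)"
  "contract x (\<lambda>S. \<Sum>i\<in>A. \<chi> i S) = (\<lambda>S. \<Sum>i\<in>A. contract x (\<chi> i) S)"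
  "contract x (\<lambda>S. 0) = (\<lambda>S. 0)"
  "basis_wedge x (\<lambda>S. \<phi> S + \<psi> S) = (\<lambda>S. basis_wedge x \<phi> S + basis_wedge x \<psi> S)"
  "basis_wedge x (\<lambda>S. \<phi> S - \<psi> S) = (\<lambda>S. basis_wedge x \<phi> S - basis_wedge x \<psi> S)"
  "basis_wedge x (\<lambda>S. - \<phi> S) = (\<lambda>S. - basis_wedge x \<phi> S)"
  "basis_wedge x (\<lambda>S. r * \<phi> S) = (\<lambda>S. r * basis_wedge x \<phi> S)"
  "basis_wedge x (\<lambda>S. \<Sum>i\<in>A. \<chi> i S) = (\<lambda>S. \<Sum>i\<in>A. basis_wedge x (\<chi> i) S)"
  "basis_wedge x (\<lambda>S. 0) = (\<lambda>S. 0)"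
  by (auto simp: fun_eq_iff contract_def basis_wedge_def algebra_simps sum_distrib_left)

lemma wedge_linear:
  "wedge N v (\<lambda>S. \<phi> S + \<psi> S) = (\<lambda>S. wedge N v \<phi> S + wedge N v \<psi> S)"
  "wedge N v (\<lambda>S. - \<phi> S) = (\<lambda>S. - wedge N v \<phi> S)"
  "wedge N v (\<lambda>S. r * \<phi> S) = (\<lambda>S. r * wedge N v \<phi> S)"
  "wedge N v (\<lambda>S. \<Sum>i\<in>A. \<chi> i S) = (\<lambda>S. \<Sum>i\<in>A. wedge N v (\<chi> i) S)"
  "wedge N v (\<lambda>S. 0) = (\<lambda>S. 0)"
  by (auto simp: fun_eq_iff wedge_def form_linear algebra_simps sum_distrib_left sum.distrib
      sum_negf intro: sum.swap)

lemma wedge_empty [simp]: "wedge N v \<phi> {} = 0"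
  by (simp add: wedge_def basis_wedge_def)

lemma contract_wedge:
  assumes "x \<le> N"
  shows "contract x (wedge N v \<phi>) = (\<lambda>S. v x * \<phi> S - wedge N v (contract x \<phi>) S)"
proof
  fix S
  have "contract x (wedge N v \<phi>) S = (\<Sum>y\<le>N. v y * contract x (basis_wedge y \<phi>) S)"
    unfolding wedge_def by (simp add: form_linear)
  also have "\<dots> = (\<Sum>y\<le>N. (if x = y then v y * \<phi> S else 0) - v y * basis_wedge y (contract x \<phi>) S)"
    by (intro sum.cong refl) (simp add: contract_basis_wedge algebra_simps)
  also have "\<dots> = v x * \<phi> S - wedge N v (contract x \<phi>) S"
    using assms by (simp add: sum_subtractf wedge_def)
  finally show "contract x (wedge N v \<phi>) S = v x * \<phi> S - wedge N v (contract x \<phi>) S" .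
qed

lemma basis_wedge_wedge:
  "basis_wedge x (wedge N v \<phi>) = (\<lambda>S. - wedge N v (basis_wedge x \<phi>) S)"
proof
  fix S
  have "basis_wedge x (wedge N v \<phi>) S = (\<Sum>y\<le>N. v y * basis_wedge x (basis_wedge y \<phi>) S)"
    unfolding wedge_def by (simp add: form_linear)
  also have "\<dots> = (\<Sum>y\<le>N. - (v y * basis_wedge y (basis_wedge x \<phi>) S))"
    by (subst basis_wedge_basis_wedge) simp
  finally show "basis_wedge x (wedge N v \<phi>) S = - wedge N v (basis_wedge x \<phi>) S"
    by (simp add: wedge_def sum_negf)
qed

lemma wedge_wedge: "wedge N v (wedge N w \<phi>) = (\<lambda>S. - wedge N w (wedge N v \<phi>) S)"
proof
  fix S
  have "wedge N v (wedge N w \<phi>) S = (\<Sum>x\<le>N. v x * - wedge N w (basis_wedge x \<phi>) S)"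
    unfolding wedge_def[of N v] by (simp add: basis_wedge_wedge)
  also have "\<dots> = - wedge N w (\<lambda>S. \<Sum>x\<le>N. v x * basis_wedge x \<phi> S) S"
    by (simp add: wedge_linear sum_negf)
  finally show "wedge N v (wedge N w \<phi>) S = - wedge N w (wedge N v \<phi>) S"
    by (simp add: wedge_def[of N v, abs_def])
qed

lemma wedge_cong:
  assumes "\<And>x. x \<le> N \<Longrightarrow> v x = w x"
  shows "wedge N v = wedge N w"
  using assms by (auto simp: fun_eq_iff wedge_def intro!: sum.cong)

lemma wedge_fun_upd:
  assumes "k \<le> N"
  shows "wedge N (v(k := v k + r)) \<phi> S = wedge N v \<phi> S + r * basis_wedge k \<phi> S"
proof -
  have "wedge N (v(k := v k + r)) \<phi> S =
      (\<Sum>x\<le>N. v x * basis_wedge x \<phi> S + (if k = x then r * basis_wedge x \<phi> S else 0))"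
    unfolding wedge_def by (intro sum.cong) (auto simp: algebra_simps)
  also have "\<dots> = wedge N v \<phi> S + r * basis_wedge k \<phi> S"
    using assms by (simp add: wedge_def sum.distrib)
  finally show ?thesis .
qed

definition wedges :: "nat \<Rightarrow> (nat \<Rightarrow> real) list \<Rightarrow> form \<Rightarrow> form" where
  "wedges N vs = foldr (wedge N) vs"

lemma wedges_simps [simp]:
  "wedges N [] \<phi> = \<phi>"
  "wedges N (v # vs) \<phi> = wedge N v (wedges N vs \<phi>)"
  "wedges N (vs @ ws) \<phi> = wedges N vs (wedges N ws \<phi>)"
  by (simp_all add: wedges_def)

lemma wedge_wedges:
  "wedges N vs (wedge N v \<phi>) = (\<lambda>S. (-1) ^ length vs * wedge N v (wedges N vs \<phi>) S)"
  by (induction vs) (simp_all add: wedge_linear wedge_wedge[of N v])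

text \<open>A vector that is annihilated by every factor passes through the whole product by the
  antiderivation rule \<open>contract_wedge\<close> and dies on the constant form.\<close>

lemma contract_wedges_eq_0:
  assumes A: "\<And>x. x \<in> A \<Longrightarrow> x \<le> N"
    and vs: "\<And>v. v \<in> set vs \<Longrightarrow> (\<Sum>x\<in>A. f x * v x) = 0"
  shows "(\<lambda>S. \<Sum>x\<in>A. f x * contract x (wedges N vs unit_form) S) = (\<lambda>S. 0)"
  using vs
proof (induction vs)
  case Nil
  have "contract x unit_form = (\<lambda>S. 0)" for x
    by (auto simp: fun_eq_iff contract_def unit_form_def)
  then show ?case by simp
next
  case (Cons v vs)
  let ?\<phi> = "wedges N vs unit_form"
  have "(\<Sum>x\<in>A. f x * contract x (wedge N v ?\<phi>) S) = 0" for S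
  proof -
    have "(\<Sum>x\<in>A. f x * contract x (wedge N v ?\<phi>) S) =
        (\<Sum>x\<in>A. f x * v x) * ?\<phi> S - wedge N v (\<lambda>S. \<Sum>x\<in>A. f x * contract x ?\<phi> S) S"
      using A by (simp add: contract_wedge wedge_linear algebra_simps sum_subtractf
          sum_distrib_left sum_distrib_right)
    then show ?thesis
      using Cons by (simp add: wedge_linear)
  qed
  then show ?case by simp
qed

section \<open>Growth steps on forms\<close>

text \<open>This is the pullback along the substitution \<open>e\<^sub>k \<mapsto> e\<^sub>k + e\<^bsub>k+1\<^esub>\<close>: a path that ends in column
  \<open>k\<close> was there before or has come from column \<open>k + 1\<close>.\<close>

definition hop :: "nat \<Rightarrow> form \<Rightarrow> form" where
  "hop k \<phi> S = \<phi> S + (if k \<in> S \<and> Suc k \<notin> S then \<phi> (insert (Suc k) (S - {k})) else 0)"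

definition covector_hop :: "nat \<Rightarrow> (nat \<Rightarrow> real) \<Rightarrow> nat \<Rightarrow> real" where
  "covector_hop k v = v(k := v k + v (Suc k))"

lemma hop_eq: "hop k \<phi> = (\<lambda>S. \<phi> S + basis_wedge k (contract (Suc k) \<phi>) S)"
proof
  fix S
  have "rank_sign k S = rank_sign (Suc k) (S - {k})" if "k \<in> S"
  proof -
    have "{y \<in> S. y < k} = {y \<in> S - {k}. y < Suc k}" by auto
    then show ?thesis by (simp add: rank_sign_def)
  qed
  then show "hop k \<phi> S = \<phi> S + basis_wedge k (contract (Suc k) \<phi>) S"
    by (auto simp: hop_def basis_wedge_def contract_def)
qed

lemma basis_wedge_twice [simp]: "basis_wedge k (basis_wedge k \<phi>) = (\<lambda>S. 0)"
  by (auto simp: fun_eq_iff basis_wedge_def)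

text \<open>A pullback is multiplicative. No sign appears because \<open>k\<close> and \<open>k + 1\<close> are neighbours.\<close>

lemma hop_wedge:
  assumes "Suc k \<le> N"
  shows "hop k (wedge N v \<phi>) = wedge N (covector_hop k v) (hop k \<phi>)"
proof
  fix S
  have "hop k (wedge N v \<phi>) S = wedge N v (hop k \<phi>) S + v (Suc k) * basis_wedge k \<phi> S"
    using assms
    by (simp add: hop_eq contract_wedge form_linear basis_wedge_wedge wedge_linear)
  also have "basis_wedge k \<phi> = basis_wedge k (hop k \<phi>)"
    by (simp add: hop_eq form_linear)
  finally show "hop k (wedge N v \<phi>) S = wedge N (covector_hop k v) (hop k \<phi>) S"
    using assms by (simp add: covector_hop_def wedge_fun_upd)
qed

text \<open>The hops are carried out from the right to the left, so that a path may continue to move left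
  through several columns; on covectors this produces suffix sums.\<close>

fun sweep :: "nat \<Rightarrow> form \<Rightarrow> form" where
  "sweep 0 \<phi> = \<phi>"
| "sweep (Suc k) \<phi> = sweep k (hop k \<phi>)"

fun covector_sweep :: "nat \<Rightarrow> (nat \<Rightarrow> real) \<Rightarrow> nat \<Rightarrow> real" where
  "covector_sweep 0 v = v"
| "covector_sweep (Suc k) v = covector_sweep k (covector_hop k v)"

lemma covector_sweep_eq:
  "covector_sweep k v y = (if y \<le> k then \<Sum>x=y..k. v x else v y)"
proof (induction k arbitrary: v)
  case (Suc k)
  have "(\<Sum>x=y..k. covector_hop k v x) = (\<Sum>x=y..Suc k. v x)" if "y \<le> k"
  proof -
    have "(\<Sum>x=y..k. covector_hop k v x) = (\<Sum>x=y..k. v x + (if k = x then v (Suc k) else 0))"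
      by (intro sum.cong) (auto simp: covector_hop_def)
    then show ?thesis using that by (simp add: sum.distrib)
  qed
  then show ?case
    by (auto simp: Suc.IH covector_hop_def le_Suc_eq)
qed auto

lemma sweep_wedge:
  "k \<le> N \<Longrightarrow> sweep k (wedge N v \<phi>) = wedge N (covector_sweep k v) (sweep k \<phi>)"
  by (induction k arbitrary: v \<phi>) (simp_all add: hop_wedge)

lemma sweep_wedges:
  "k \<le> N \<Longrightarrow> sweep k (wedges N vs \<phi>) = wedges N (map (covector_sweep k) vs) (sweep k \<phi>)"
  by (induction vs) (simp_all add: sweep_wedge)

lemma hop_unit_form [simp]: "hop k unit_form = unit_form"
  by (auto simp: fun_eq_iff hop_def unit_form_def)

lemma sweep_unit_form [simp]: "sweep k unit_form = unit_form"
  by (induction k) simp_all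

text \<open>Right multiplication by the dual covector of \<open>e\<^sub>k\<close>, for a \<open>k\<close> beyond all indices in use; it
  carries no sign, whereas left multiplication would.\<close>

definition append_basis :: "nat \<Rightarrow> form \<Rightarrow> form" where
  "append_basis k \<phi> S = (if k \<in> S then \<phi> (S - {k}) else 0)"

lemma append_basis_wedge:
  assumes "\<And>x. x \<ge> k \<Longrightarrow> v x = 0"
  shows "append_basis k (wedge N v \<phi>) = wedge N v (append_basis k \<phi>)"
proof
  fix S
  have "v x * basis_wedge x \<phi> (S - {k}) = v x * basis_wedge x (append_basis k \<phi>) S"
    if "k \<in> S" for x
  proof (cases "x < k")
    case True
    have "{y \<in> S - {k}. y < x} = {y \<in> S. y < x}" using True by auto
    moreover have "S - {k} - {x} = S - {x} - {k}" by auto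
    ultimately show ?thesis using True that
      by (simp add: basis_wedge_def append_basis_def rank_sign_def)
  qed (use assms in auto)
  then have "k \<in> S \<Longrightarrow> (\<Sum>x\<le>N. v x * basis_wedge x \<phi> (S - {k})) =
      (\<Sum>x\<le>N. v x * basis_wedge x (append_basis k \<phi>) S)"
    by (intro sum.cong) blast+
  moreover have "basis_wedge x (append_basis k \<phi>) S = 0" if "k \<notin> S" for x
    using that by (simp add: basis_wedge_def append_basis_def)
  ultimately show "append_basis k (wedge N v \<phi>) S = wedge N v (append_basis k \<phi>) S"
    unfolding append_basis_def[of k "wedge N v \<phi>"] wedge_def by simp
qed

lemma append_basis_wedges:
  assumes "\<And>v x. v \<in> set vs \<Longrightarrow> x \<ge> k \<Longrightarrow> v x = 0"
  shows "append_basis k (wedges N vs \<phi>) = wedges N vs (append_basis k \<phi>)"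
  using assms by (induction vs) (simp_all add: append_basis_wedge)

lemma append_basis_unit_form:
  assumes "k \<le> N"
  shows "append_basis k unit_form = wedge N (\<lambda>x. if x = k then 1 else 0) unit_form"
proof
  fix S
  have "wedge N (\<lambda>x. if x = k then 1 else 0) unit_form S =
      (\<Sum>x\<le>N. if k = x then basis_wedge x unit_form S else 0)"
    unfolding wedge_def by (intro sum.cong) auto
  also have "\<dots> = basis_wedge k unit_form S"
    using assms by simp
  also have "\<dots> = append_basis k unit_form S"
  proof (cases "S = {k}")
    case False
    then have "\<not> (k \<in> S \<and> S - {k} = {})" by auto
    then show ?thesis
      by (auto simp: basis_wedge_def append_basis_def unit_form_def)
  next
    case True
    then have "{y \<in> S. y < k} = {}" by auto
    with True show ?thesis
      by (simp only: basis_wedge_def append_basis_def rank_sign_def) simp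
  qed
  finally show "append_basis k unit_form S = wedge N (\<lambda>x. if x = k then 1 else 0) unit_form S" ..
qed

text \<open>Double contraction with neighbouring basis vectors \<open>e\<^sub>k\<close>, \<open>e\<^bsub>k+1\<^esub>\<close>; their signs cancel. The
  product of all the operators \<open>pair_up k\<close> is the exponential of contraction with
  \<open>\<Sum>\<^sub>k e\<^sub>k \<and> e\<^bsub>k+1\<^esub>\<close>, as in Pfaffian minor summation.\<close>

definition pair_up :: "nat \<Rightarrow> form \<Rightarrow> form" where
  "pair_up k \<phi> S =
     \<phi> S + (if k \<notin> S \<and> Suc k \<notin> S then \<phi> (insert k (insert (Suc k) S)) else 0)"

lemma pair_up_eq: "pair_up k \<phi> = (\<lambda>S. \<phi> S + contract (Suc k) (contract k \<phi>) S)"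
proof
  fix S
  have "rank_sign (Suc k) S = rank_sign k S" if "k \<notin> S"
  proof -
    have "{y \<in> S. y < Suc k} = {y \<in> S. y < k}" using that by (auto simp: less_Suc_eq)
    then show ?thesis by (simp add: rank_sign_def)
  qed
  then show "pair_up k \<phi> S = \<phi> S + contract (Suc k) (contract k \<phi>) S"
    by (auto simp: pair_up_def contract_def rank_sign_insert)
qed

lemma pair_up_linear:
  "pair_up k (\<lambda>S. \<phi> S + \<psi> S) = (\<lambda>S. pair_up k \<phi> S + pair_up k \<psi> S)"
  "pair_up k (\<lambda>S. \<phi> S - \<psi> S) = (\<lambda>S. pair_up k \<phi> S - pair_up k \<psi> S)"
  "pair_up k (\<lambda>S. r * \<phi> S) = (\<lambda>S. r * pair_up k \<phi> S)"
  "pair_up k (\<lambda>S. \<Sum>i\<in>A. \<chi> i S) = (\<lambda>S. \<Sum>i\<in>A. pair_up k (\<chi> i) S)"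
  "pair_up k (\<lambda>S. 0) = (\<lambda>S. 0)"
  by (auto simp: fun_eq_iff pair_up_eq form_linear algebra_simps sum.distrib sum_distrib_left)

lemma contract_pair_up: "contract x (pair_up k \<phi>) = pair_up k (contract x \<phi>)"
  by (simp add: pair_up_eq form_linear contract_contract[of x "Suc k"] contract_contract[of x k])

lemma contract_pair_up_absorb:
  "contract k (pair_up k \<phi>) = contract k \<phi>"
  "contract (Suc k) (pair_up k \<phi>) = contract (Suc k) \<phi>"
  by (simp_all add: pair_up_eq form_linear contract_contract[of k "Suc k"] fun_eq_iff)

text \<open>Moving the two contractions past \<open>v\<close> by \<open>contract_wedge\<close> leaves one contraction. Its argument
  may be taken to be \<open>pair_up k \<phi>\<close> instead of \<open>\<phi>\<close>, by \<open>contract_pair_up_absorb\<close>, and in that shape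
  the defects of successive pairings simply add up.\<close>

lemma pair_up_wedge:
  assumes "Suc k \<le> N"
  shows "pair_up k (wedge N v \<phi>) = (\<lambda>S. wedge N v (pair_up k \<phi>) S
    + (v k * contract (Suc k) (pair_up k \<phi>) S - v (Suc k) * contract k (pair_up k \<phi>) S))"
  unfolding contract_pair_up_absorb using assms
  by (simp add: pair_up_eq contract_wedge form_linear wedge_linear fun_eq_iff)

fun pair_range :: "nat \<Rightarrow> nat \<Rightarrow> form \<Rightarrow> form" where
  "pair_range a 0 \<phi> = \<phi>"
| "pair_range a (Suc m) \<phi> = pair_up (a + m) (pair_range a m \<phi>)"

lemma pair_range_add: "pair_range a (k + m) \<phi> = pair_range (a + k) m (pair_range a k \<phi>)"
  by (induction m) (simp_all add: add.assoc)

lemma pair_range_linear: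
  "pair_range a m (\<lambda>S. \<phi> S + \<psi> S) = (\<lambda>S. pair_range a m \<phi> S + pair_range a m \<psi> S)"
  "pair_range a m (\<lambda>S. \<phi> S - \<psi> S) = (\<lambda>S. pair_range a m \<phi> S - pair_range a m \<psi> S)"
  "pair_range a m (\<lambda>S. r * \<phi> S) = (\<lambda>S. r * pair_range a m \<phi> S)"
  "pair_range a m (\<lambda>S. \<Sum>i\<in>A. \<chi> i S) = (\<lambda>S. \<Sum>i\<in>A. pair_range a m (\<chi> i) S)"
  "pair_range a m (\<lambda>S. 0) = (\<lambda>S. 0)"
  by (induction m) (simp_all add: pair_up_linear)

lemma contract_pair_range: "contract x (pair_range a m \<phi>) = pair_range a m (contract x \<phi>)"
  by (induction m) (simp_all add: contract_pair_up)

lemma pair_range_wedge: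
  "m \<le> N \<Longrightarrow> pair_range 0 m (wedge N v \<phi>) = (\<lambda>S. wedge N v (pair_range 0 m \<phi>) S
    + (\<Sum>k<m. v k * contract (Suc k) (pair_range 0 m \<phi>) S
              - v (Suc k) * contract k (pair_range 0 m \<phi>) S))"
proof (induction m)
  case (Suc m)
  then have "pair_range 0 (Suc m) (wedge N v \<phi>) = pair_up m (\<lambda>S. wedge N v (pair_range 0 m \<phi>) S
    + (\<Sum>k<m. v k * contract (Suc k) (pair_range 0 m \<phi>) S
              - v (Suc k) * contract k (pair_range 0 m \<phi>) S))"
    by simp
  then show ?case
    using Suc.prems by (simp add: pair_up_linear pair_up_wedge algebra_simps flip: contract_pair_up)
qed simp

text \<open>Restriction to the vectors \<open>e\<^sub>2, e\<^sub>3, \<dots>\<close>, renumbered from \<open>0\<close>. It corresponds to the copy of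
  \<open>G\<^bsub>n-1\<^esub>\<close> in \<open>G\<^sub>n\<close> translated by \<open>(2, 2)\<close>.\<close>

definition shift_form :: "form \<Rightarrow> form" where
  "shift_form \<phi> S = \<phi> ((\<lambda>x. x + 2) ` S)"

lemma rank_sign_shift: "rank_sign (x + 2) ((\<lambda>x. x + 2) ` S) = rank_sign x S"
proof -
  have "{y \<in> (\<lambda>x. x + 2) ` S. y < x + 2} = (\<lambda>x. x + 2) ` {y \<in> S. y < x}" by auto
  moreover have "inj_on (\<lambda>x. x + 2) {y \<in> S. y < x}" by (simp add: inj_on_def)
  ultimately show ?thesis
    by (simp only: rank_sign_def card_image)
qed

lemma shift_contract: "shift_form (contract (x + 2) \<phi>) = contract x (shift_form \<phi>)"
  using rank_sign_shift[of x] by (auto simp: fun_eq_iff shift_form_def contract_def)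

lemma shift_basis_wedge:
  "shift_form (basis_wedge (x + 2) \<phi>) = basis_wedge x (shift_form \<phi>)"
proof
  fix S
  have "(\<lambda>x. x + 2) ` S - {x + 2} = (\<lambda>x. x + 2) ` (S - {x})" by auto
  then show "shift_form (basis_wedge (x + 2) \<phi>) S = basis_wedge x (shift_form \<phi>) S"
    using rank_sign_shift[of x] by (auto simp: shift_form_def basis_wedge_def)
qed

lemma shift_wedge:
  "shift_form (wedge (N + 2) v \<phi>) = wedge N (\<lambda>x. v (x + 2)) (shift_form \<phi>)"
proof
  fix S
  let ?w = "\<lambda>x. v x * shift_form (basis_wedge x \<phi>) S"
  have "shift_form (wedge (N + 2) v \<phi>) S = (\<Sum>x\<le>Suc (Suc N). ?w x)"
    by (simp add: shift_form_def wedge_def)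
  also have "\<dots> = ?w 0 + (?w 1 + (\<Sum>x\<le>N. ?w (x + 2)))"
    by (subst sum.atMost_Suc_shift, subst sum.atMost_Suc_shift) simp
  \<comment> \<open>The components at 0 and 1 vanish, since these indices are missing from a shifted set.\<close>
  also have "\<dots> = (\<Sum>x\<le>N. ?w (x + 2))"
    by (auto simp: shift_form_def basis_wedge_def)
  finally show "shift_form (wedge (N + 2) v \<phi>) S = wedge N (\<lambda>x. v (x + 2)) (shift_form \<phi>) S"
    by (simp only: shift_basis_wedge wedge_def)
qed

lemma shift_wedges:
  "shift_form (wedges (N + 2) vs \<phi>) = wedges N (map (\<lambda>v x. v (x + 2)) vs) (shift_form \<phi>)"
  by (induction vs) (simp_all only: wedges_simps list.map shift_wedge)

lemma shift_unit_form [simp]: "shift_form unit_form = unit_form"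
  by (auto simp: fun_eq_iff shift_form_def unit_form_def)

lemma shift_pair_up: "shift_form (pair_up (k + 2) \<phi>) = pair_up k (shift_form \<phi>)"
proof -
  have "shift_form (pair_up (k + 2) \<phi>) = 
     (\<lambda>S. shift_form \<phi> S + shift_form (contract (Suc k + 2) (contract (k + 2) \<phi>)) S)"
    by (simp add: fun_eq_iff pair_up_eq shift_form_def)
  then show ?thesis
    by (simp only: shift_contract pair_up_eq)
qed

lemma shift_pair_range: "shift_form (pair_range 2 m \<phi>) = pair_range 0 m (shift_form \<phi>)"
  by (induction m) (simp_all only: pair_range.simps add.commute[of 2] add_0 shift_pair_up)

lemma shift_empty: "shift_form \<phi> {} = \<phi> {}"
  by (simp add: shift_form_def)

section \<open>Counting perfect matchings\<close>

definition matching_count :: "'v set set \<Rightarrow> 'v set \<Rightarrow> nat" where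
  "matching_count E U = card (perfect_matchings U (induced_edges U E))"

lemma perfect_matchingsI:
  assumes "\<And>e. e \<in> M \<Longrightarrow> e \<in> E" "\<And>e. e \<in> M \<Longrightarrow> e \<subseteq> U"
    "\<And>v. v \<in> U \<Longrightarrow> \<exists>e\<in>M. v \<in> e"
    "\<And>v e e'. v \<in> U \<Longrightarrow> e \<in> M \<Longrightarrow> e' \<in> M \<Longrightarrow> v \<in> e \<Longrightarrow> v \<in> e' \<Longrightarrow> e = e'"
  shows "M \<in> perfect_matchings U (induced_edges U E)"
  unfolding perfect_matchings_def induced_edges_def using assms by blast

lemma perfect_matchingsD:
  assumes "M \<in> perfect_matchings U (induced_edges U E)"
  shows "e \<in> M \<Longrightarrow> e \<in> E" "e \<in> M \<Longrightarrow> e \<subseteq> U"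
    "v \<in> U \<Longrightarrow> \<exists>e\<in>M. v \<in> e"
    "v \<in> U \<Longrightarrow> e \<in> M \<Longrightarrow> e' \<in> M \<Longrightarrow> v \<in> e \<Longrightarrow> v \<in> e' \<Longrightarrow> e = e'"
  using assms unfolding perfect_matchings_def induced_edges_def by blast+

lemma finite_perfect_matchings:
  assumes "finite U"
  shows "finite (perfect_matchings U (induced_edges U E))"
proof (rule finite_subset)
  show "perfect_matchings U (induced_edges U E) \<subseteq> Pow (Pow U)"
    by (auto simp: perfect_matchings_def induced_edges_def)
qed (use assms in simp)

text \<open>Removing the edge \<open>{a, b}\<close> from such a matching is a bijection onto the perfect matchings of
  the rest, because every other edge of the matching avoids \<open>a\<close> and \<open>b\<close>.\<close>

lemma card_matchings_through_edge:
  assumes "a \<in> U" "b \<in> U" "{a, b} \<in> E"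
  shows "card {M \<in> perfect_matchings U (induced_edges U E). {a, b} \<in> M}
       = matching_count E (U - {a, b})"
  unfolding matching_count_def
proof (rule bij_betw_same_card)
  let ?A = "{M \<in> perfect_matchings U (induced_edges U E). {a, b} \<in> M}"
  let ?B = "perfect_matchings (U - {a, b}) (induced_edges (U - {a, b}) E)"
  have disjoint: "e \<inter> {a, b} = {}" if "M \<in> ?A" "e \<in> M" "e \<noteq> {a, b}" for M e
    using that perfect_matchingsD(4)[of M U E a e "{a, b}"]
      perfect_matchingsD(4)[of M U E b e "{a, b}"] assms by blast
  show "bij_betw (\<lambda>M. M - {{a, b}}) ?A ?B"
  proof (rule bij_betw_byWitness[where f' = "insert {a, b}"])
    show "\<forall>M\<in>?A. insert {a, b} (M - {{a, b}}) = M" by auto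
    show "\<forall>M\<in>?B. insert {a, b} M - {{a, b}} = M"
      using perfect_matchingsD(2) by fastforce
    show "(\<lambda>M. M - {{a, b}}) ` ?A \<subseteq> ?B"
    proof (intro image_subsetI perfect_matchingsI)
      fix M assume M: "M \<in> ?A"
      then have M': "M \<in> perfect_matchings U (induced_edges U E)" by simp
      show "e \<in> E" if "e \<in> M - {{a, b}}" for e
        using perfect_matchingsD(1)[OF M'] that by blast
      show "e \<subseteq> U - {a, b}" if "e \<in> M - {{a, b}}" for e
        using perfect_matchingsD(2)[OF M'] disjoint[OF M] that by blast
      show "\<exists>e\<in>M - {{a, b}}. v \<in> e" if "v \<in> U - {a, b}" for v
        using perfect_matchingsD(3)[OF M'] that by blast
      show "e = e'" if "v \<in> U - {a, b}" "e \<in> M - {{a, b}}" "e' \<in> M - {{a, b}}"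
        "v \<in> e" "v \<in> e'" for v e e'
        using perfect_matchingsD(4)[OF M'] that by blast
    qed
    show "insert {a, b} ` ?B \<subseteq> ?A"
    proof (intro image_subsetI CollectI conjI perfect_matchingsI)
      fix M assume M: "M \<in> ?B"
      show "e \<in> E" if "e \<in> insert {a, b} M" for e
        using perfect_matchingsD(1)[OF M] that assms by blast
      show "e \<subseteq> U" if "e \<in> insert {a, b} M" for e
        using perfect_matchingsD(2)[OF M] that assms by blast
      show "\<exists>e\<in>insert {a, b} M. v \<in> e" if "v \<in> U" for v
        using perfect_matchingsD(3)[OF M] that by blast
      show "e = e'" if "v \<in> U" "e \<in> insert {a, b} M" "e' \<in> insert {a, b} M"
        "v \<in> e" "v \<in> e'" for v e e'
      proof (cases "v \<in> {a, b}")
        case True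
        then have "v \<notin> f" if "f \<in> M" for f
          using perfect_matchingsD(2)[OF M that] by blast
        with that show ?thesis by blast
      next
        case False
        with that show ?thesis using perfect_matchingsD(4)[OF M] by blast
      qed
    qed simp
  qed
qed

text \<open>Perfect matchings are sorted by the partner of \<open>v\<close>.\<close>

lemma matching_count_expand:
  assumes "finite U" "v \<in> U"
    and edges: "\<And>e. e \<in> E \<Longrightarrow> v \<in> e \<Longrightarrow> \<exists>w. w \<noteq> v \<and> e = {v, w}"
    and A: "A = {w \<in> U. w \<noteq> v \<and> {v, w} \<in> E}"
  shows "matching_count E U = (\<Sum>w\<in>A. matching_count E (U - {v, w}))"
proof -
  let ?P = "perfect_matchings U (induced_edges U E)"
  let ?Q = "\<lambda>w. {M \<in> ?P. {v, w} \<in> M}"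
  have "\<exists>w\<in>A. M \<in> ?Q w" if M: "M \<in> ?P" for M
  proof -
    obtain e where "e \<in> M" "v \<in> e" using perfect_matchingsD(3)[OF M \<open>v \<in> U\<close>] by blast
    with edges perfect_matchingsD(1)[OF M] obtain w where "w \<noteq> v" "e = {v, w}" by blast
    with \<open>e \<in> M\<close> perfect_matchingsD(1,2)[OF M] M show ?thesis
      unfolding A by blast
  qed
  then have "?P = (\<Union>w\<in>A. ?Q w)" by blast
  moreover have "card (\<Union>w\<in>A. ?Q w) = (\<Sum>w\<in>A. card (?Q w))"
  proof (rule card_UN_disjoint)
    show "\<forall>w\<in>A. \<forall>w'\<in>A. w \<noteq> w' \<longrightarrow> ?Q w \<inter> ?Q w' = {}"
    proof (intro ballI impI equals0I)
      fix w w' M assume "w \<in> A" "w' \<in> A" "w \<noteq> w'" "M \<in> ?Q w \<inter> ?Q w'"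
      then have "{v, w} = {v, w'}"
        using perfect_matchingsD(4)[of M U E v "{v, w}" "{v, w'}"] \<open>v \<in> U\<close> by blast
      with \<open>w \<noteq> w'\<close> show False by (metis doubleton_eq_iff)
    qed
  qed (use assms finite_perfect_matchings[of U E] in auto)
  moreover have "card (?Q w) = matching_count E (U - {v, w})" if "w \<in> A" for w
    using card_matchings_through_edge[of v U w E] that \<open>v \<in> U\<close> by (simp add: A)
  ultimately show ?thesis by (simp add: matching_count_def)
qed

lemma matching_count_add_edge:
  assumes "finite U" "a \<noteq> b" "{a, b} \<notin> E"
  shows "matching_count (insert {a, b} E) U =
    matching_count E U + (if a \<in> U \<and> b \<in> U then matching_count E (U - {a, b}) else 0)"
proof (cases "a \<in> U \<and> b \<in> U")
  case True
  let ?P = "perfect_matchings U (induced_edges U (insert {a, b} E))"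
  have "?P = {M \<in> ?P. {a, b} \<in> M} \<union> perfect_matchings U (induced_edges U E)"
    unfolding perfect_matchings_def induced_edges_def by auto
  moreover have "{M \<in> ?P. {a, b} \<in> M} \<inter> perfect_matchings U (induced_edges U E) = {}"
    using assms(3) unfolding perfect_matchings_def induced_edges_def by auto
  ultimately have "card ?P = card {M \<in> ?P. {a, b} \<in> M}
      + card (perfect_matchings U (induced_edges U E))"
    using card_Un_disjoint[of "{M \<in> ?P. {a, b} \<in> M}" "perfect_matchings U (induced_edges U E)"]
      finite_perfect_matchings[OF assms(1)] by simp
  moreover have "card {M \<in> ?P. {a, b} \<in> M} = matching_count (insert {a, b} E) (U - {a, b})"
    using card_matchings_through_edge[of a U b "insert {a, b} E"] True by simp
  moreover have "induced_edges (U - {a, b}) (insert {a, b} E) = induced_edges (U - {a, b}) E"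
    by (auto simp: induced_edges_def)
  ultimately show ?thesis using True by (simp add: matching_count_def)
next
  case False
  then have "induced_edges U (insert {a, b} E) = induced_edges U E"
    by (auto simp: induced_edges_def)
  then show ?thesis using False by (auto simp: matching_count_def)
qed

lemma matching_count_empty:
  assumes "{} \<notin> E"
  shows "matching_count E {} = 1"
proof -
  have "perfect_matchings {} (induced_edges {} E) = {{}}"
    using assms by (auto simp: perfect_matchings_def induced_edges_def)
  then show ?thesis by (simp add: matching_count_def)
qed

text \<open>Here \<open>f\<close> numbers the lowest vertices of the columns in \<open>I\<close>. The value is zero when some index
  has no vertex, since no path can leave through a missing vertex; this is what makes the
  growth steps below uniform at the right boundary.\<close>

definition removal_form :: "'v set set \<Rightarrow> 'v set \<Rightarrow> nat set \<Rightarrow> (nat \<Rightarrow> 'v) \<Rightarrow> form" where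
  "removal_form E U I f S = (if S \<subseteq> I then real (matching_count E (U - f ` S)) else 0)"

locale simple_edges =
  fixes E :: "'v set set"
  assumes edge_pair: "e \<in> E \<Longrightarrow> \<exists>p q. p \<noteq> q \<and> e = {p, q}"
begin

lemma edge_form:
  assumes "e \<in> E" "v \<in> e"
  shows "\<exists>w. w \<noteq> v \<and> e = {v, w}"
  using edge_pair[OF assms(1)] assms(2) by (auto simp: insert_commute)

lemma matching_count_leaf:
  assumes "finite U" "v \<in> U" "w \<in> U" "v \<noteq> w" "{v, w} \<in> E"
    and "\<And>u. u \<in> U \<Longrightarrow> {v, u} \<in> E \<Longrightarrow> u = w"
  shows "matching_count E U = matching_count E (U - {v, w})"
proof -
  have "{w} = {u \<in> U. u \<noteq> v \<and> {v, u} \<in> E}" using assms by blast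
  from matching_count_expand[OF assms(1,2) edge_form this] show ?thesis by simp
qed

lemma matching_count_isolated:
  assumes "finite U" "v \<in> U" "\<And>u. u \<in> U \<Longrightarrow> {v, u} \<notin> E"
  shows "matching_count E U = 0"
proof -
  have "{} = {u \<in> U. u \<noteq> v \<and> {v, u} \<in> E}" using assms by blast
  from matching_count_expand[OF assms(1,2) edge_form this] show ?thesis by simp
qed

text \<open>An isolated vertex must be among the removed ones.\<close>

lemma removal_form_append:
  assumes U: "finite U" "inj_on f I" "f ` I \<subseteq> U"
    and new: "x \<notin> U" "k \<notin> I" "\<And>w. w \<in> U \<Longrightarrow> {x, w} \<notin> E"
  shows "removal_form E (insert x U) (insert k I) (f(k := x)) = append_basis k (removal_form E U I f)"
proof
  fix S
  show "removal_form E (insert x U) (insert k I) (f(k := x)) S = append_basis k (removal_form E U I f) S"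
  proof (cases "S \<subseteq> insert k I")
    case True
    show ?thesis
    proof (cases "k \<in> S")
      case k: True
      have "f(k := x) ` S = insert x (f ` (S - {k}))" using k by auto
      then have "insert x U - f(k := x) ` S = U - f ` (S - {k})"
        using new by auto
      then show ?thesis using k True
        by (simp add: removal_form_def append_basis_def subset_insert_iff)
    next
      case False
      let ?V = "insert x U - f(k := x) ` S"
      have "f(k := x) ` S = f ` S" using False by auto
      moreover have "S \<subseteq> I" using False True by auto
      ultimately have "x \<in> ?V" using U new by auto
      then have "matching_count E ?V = 0"
      proof (rule matching_count_isolated[rotated])
        show "{x, w} \<notin> E" if "w \<in> ?V" for w
          using that new(3) edge_form[of "{x, w}" x] by (auto simp: doubleton_eq_iff)
      qed (use U(1) in simp)
      then show ?thesis using False True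
        by (simp add: removal_form_def append_basis_def)
    qed
  qed (auto simp: removal_form_def append_basis_def)
qed

text \<open>Two vertices \<open>x\<close>, \<open>y\<close> are added under column \<open>k\<close>; \<open>x\<close> becomes its lowest vertex and is
  attached to \<open>y\<close> only, while \<open>y\<close> sees the old lowest vertices of the columns \<open>k\<close> and \<open>k + 1\<close>. If
  \<open>x\<close> is not removed, it is a leaf and disappears together with \<open>y\<close>. If \<open>x\<close> is removed, \<open>y\<close> is
  matched to one of the two old vertices, which amounts to removing that one instead of \<open>x\<close>.\<close>

lemma removal_form_hop:
  assumes U: "finite U" "inj_on f I" "f ` I \<subseteq> U"
    and new: "x \<notin> U" "y \<notin> U" "x \<noteq> y" "{x, y} \<in> E"
    and nx: "\<And>w. w \<in> U \<Longrightarrow> {x, w} \<notin> E"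
    and ny: "\<And>w. w \<in> U \<Longrightarrow> {y, w} \<in> E \<longleftrightarrow> w \<in> f ` (I \<inter> {k, Suc k})"
  shows "removal_form E (insert x (insert y U)) (insert k I) (f(k := x)) = hop k (removal_form E U I f)"
proof
  fix S
  let ?f = "f(k := x)"
  let ?V = "insert x (insert y U) - ?f ` S"
  show "removal_form E (insert x (insert y U)) (insert k I) ?f S = hop k (removal_form E U I f) S"
  proof (cases "S \<subseteq> insert k I")
    case S: True
    show ?thesis
    proof (cases "k \<in> S")
      case k: True
      have fS: "?f ` S = insert x (f ` (S - {k}))" using k by auto
      have SI: "S - {k} \<subseteq> I" using S by auto
      have V: "?V = insert y (U - f ` (S - {k}))" using fS new SI U by auto
      have fk: "insert (f k) (f ` (S - {k})) = f ` S" using k by blast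
      let ?A = "f ` (I \<inter> {k, Suc k} - (S - {k}))"
      have A: "?A = {w \<in> ?V. w \<noteq> y \<and> {y, w} \<in> E}"
      proof -
        have "?A = f ` (I \<inter> {k, Suc k}) - f ` (S - {k})"
          by (rule inj_on_image_set_diff[OF U(2)]) (use SI in auto)
        also have "\<dots> = {w \<in> U - f ` (S - {k}). {y, w} \<in> E}"
          using U(3) by (auto simp: ny)
        also have "\<dots> = {w \<in> ?V. w \<noteq> y \<and> {y, w} \<in> E}"
          unfolding V using new(2) by blast
        finally show ?thesis .
      qed
      have "matching_count E ?V = (\<Sum>w\<in>?A. matching_count E (?V - {y, w}))"
      proof (rule matching_count_expand[OF _ _ edge_form A])
        show "finite ?V" using U(1) by simp
        show "y \<in> ?V" unfolding V by simp
      qed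
      also have "\<dots> = (\<Sum>i\<in>I \<inter> {k, Suc k} - (S - {k}). matching_count E (?V - {y, f i}))"
        by (subst sum.reindex) (auto intro: inj_on_subset[OF U(2)])
      also have "\<dots> = (\<Sum>i\<in>I \<inter> {k, Suc k} - (S - {k}). matching_count E (U - f ` insert i (S - {k})))"
      proof (intro sum.cong refl arg_cong[of _ _ "matching_count E"])
        fix i
        show "?V - {y, f i} = U - f ` insert i (S - {k})"
          unfolding V using new(2) by blast
      qed
      also have "I \<inter> {k, Suc k} - (S - {k}) =
          (if k \<in> I then {k} else {}) \<union> (if Suc k \<in> I \<and> Suc k \<notin> S then {Suc k} else {})"
        using k by auto
      also have "(\<Sum>i\<in>\<dots>. matching_count E (U - f ` insert i (S - {k}))) =
          (if k \<in> I then matching_count E (U - f ` S) else 0) +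
          (if Suc k \<in> I \<and> Suc k \<notin> S then matching_count E (U - f ` insert (Suc k) (S - {k})) else 0)"
        using k fk by (subst sum.union_disjoint) auto
      finally have "matching_count E ?V = \<dots>" .
      moreover have "S \<subseteq> I \<longleftrightarrow> k \<in> I" "insert (Suc k) (S - {k}) \<subseteq> I \<longleftrightarrow> Suc k \<in> I"
        using k SI by auto
      ultimately show ?thesis using k S
        by (auto simp: removal_form_def hop_def)
    next
      case False
      have fS: "?f ` S = f ` S" using False by auto
      have SI: "S \<subseteq> I" using S False by auto
      have V: "?V = insert x (insert y (U - f ` S))" using fS new SI U by auto
      have "matching_count E ?V = matching_count E (?V - {x, y})"
      proof (rule matching_count_leaf)
        show "w = y" if "w \<in> ?V" "{x, w} \<in> E" for w
          using that nx edge_form[of "{x, w}" x] unfolding V by (auto simp: doubleton_eq_iff)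
        show "x \<in> ?V" "y \<in> ?V" unfolding V by simp_all
      qed (use U(1) new in simp_all)
      also have "?V - {x, y} = U - f ` S" unfolding V using new by auto
      finally show ?thesis using False S SI
        by (simp add: removal_form_def hop_def)
    qed
  next
    case False
    then have "\<not> S \<subseteq> I" "\<not> insert (Suc k) (S - {k}) \<subseteq> I" by auto
    then show ?thesis using False
      unfolding removal_form_def hop_def by (simp only: if_False if_cancel add_0)
  qed
qed

end

text \<open>Perfect matchings that use the new edge are those of the graph without its two ends.\<close>

lemma removal_form_pair_up:
  assumes U: "finite U" "inj_on f I" "f ` I \<subseteq> U"
    and new: "a = f k" "b = f (Suc k)" "a \<noteq> b" "{a, b} \<notin> E"
    and iff: "k \<in> I \<longleftrightarrow> a \<in> U" "Suc k \<in> I \<longleftrightarrow> b \<in> U"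
  shows "removal_form (insert {a, b} E) U I f = pair_up k (removal_form E U I f)"
proof
  fix S
  show "removal_form (insert {a, b} E) U I f S = pair_up k (removal_form E U I f) S"
  proof (cases "S \<subseteq> I")
    case S: True
    have "a \<in> f ` S \<longleftrightarrow> k \<in> S" if "k \<in> I"
      unfolding new(1) using inj_on_image_mem_iff[OF U(2) that S] .
    moreover have "b \<in> f ` S \<longleftrightarrow> Suc k \<in> S" if "Suc k \<in> I"
      unfolding new(2) using inj_on_image_mem_iff[OF U(2) that S] .
    ultimately have present: "a \<in> U - f ` S \<and> b \<in> U - f ` S \<longleftrightarrow>
        (k \<notin> S \<and> Suc k \<notin> S) \<and> insert k (insert (Suc k) S) \<subseteq> I"
      using iff S by blast
    have "U - f ` S - {a, b} = U - f ` insert k (insert (Suc k) S)"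
      unfolding new(1,2) by blast
    then have "matching_count (insert {a, b} E) (U - f ` S) = matching_count E (U - f ` S) +
        (if (k \<notin> S \<and> Suc k \<notin> S) \<and> insert k (insert (Suc k) S) \<subseteq> I
         then matching_count E (U - f ` insert k (insert (Suc k) S)) else 0)"
      using matching_count_add_edge[OF _ new(3,4), of "U - f ` S"] U(1)
      unfolding present by simp
    then show ?thesis using S
      unfolding removal_form_def pair_up_def by (simp del: image_insert)
  next
    case False
    then have "\<not> insert k (insert (Suc k) S) \<subseteq> I" by auto
    then show ?thesis using False
      unfolding removal_form_def pair_up_def by (simp only: if_False if_cancel add_0)
  qed
qed

section \<open>Growing the graph\<close>

text \<open>The diagonal edges are left out at first; the remaining graph is bipartite by the parity of
  \<open>x\<^sub>1 + x\<^sub>2\<close>.\<close>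

definition lattice_edges :: "nat \<Rightarrow> vertex set set" where
  "lattice_edges n = horizontal_edges n \<union> vertical_edges n"

lemma horizontal_edgeI:
  assumes "0 \<le> x" "x \<le> 2 * int n - 1" "x \<le> y" "y \<le> 2 * int n + 1" "(x + y) mod 2 = 1"
  shows "{(x, y), (x + 1, y)} \<in> lattice_edges n"
  unfolding lattice_edges_def horizontal_edges_def using assms by blast

lemma vertical_edgeI:
  assumes "0 \<le> x" "x \<le> 2 * int n - int n mod 2" "x \<le> y" "y \<le> 2 * int n"
  shows "{(x, y), (x, y + 1)} \<in> lattice_edges n"
  unfolding lattice_edges_def vertical_edges_def using assms by blast

lemma lattice_edge_cases:
  assumes "{p, q} \<in> lattice_edges n"
  obtains (horizontal) x y where "{p, q} = {(x, y), (x + 1, y)}" "(x + y) mod 2 = 1"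
    | (vertical) x y where "{p, q} = {(x, y), (x, y + 1)}"
  using assms unfolding lattice_edges_def horizontal_edges_def vertical_edges_def by blast

lemma lattice_edge_range:
  assumes "e \<in> lattice_edges n" "v \<in> e"
  shows "fst v \<le> 2 * int n \<and> snd v \<le> 2 * int n + 1"
  using assms unfolding lattice_edges_def horizontal_edges_def vertical_edges_def by auto

lemma even_neighbour:
  assumes "{(a, b), w} \<in> lattice_edges n" "(a + b) mod 2 = 0"
  shows "w \<in> {(a - 1, b), (a, b + 1), (a, b - 1)}"
  using assms(1)
proof (cases rule: lattice_edge_cases)
  case (horizontal x y)
  moreover have "(a, b) \<noteq> (x, y)" using horizontal assms(2) by auto
  ultimately show ?thesis by (auto simp: doubleton_eq_iff)
qed (auto simp: doubleton_eq_iff)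

lemma odd_neighbour:
  assumes "{(a, b), w} \<in> lattice_edges n" "(a + b) mod 2 = 1"
  shows "w \<in> {(a + 1, b), (a, b + 1), (a, b - 1)}"
  using assms(1)
proof (cases rule: lattice_edge_cases)
  case (horizontal x y)
  moreover have "(a, b) \<noteq> (x + 1, y)" using horizontal assms(2) by (auto, presburger)
  ultimately show ?thesis by (auto simp: doubleton_eq_iff)
qed (auto simp: doubleton_eq_iff)

interpretation lattice: simple_edges "lattice_edges n"
proof
  fix e assume "e \<in> lattice_edges n"
  then obtain x y where "e \<in> {{(x, y), (x + 1, y)}, {(x, y), (x, y + 1)}, {(x, y), (x + 1, y + 1)}}"
    unfolding lattice_edges_def horizontal_edges_def vertical_edges_def by blast
  moreover have "(x, y) \<noteq> (x + 1, y)" "(x, y) \<noteq> (x, y + 1)" "(x, y) \<noteq> (x + 1, y + 1)"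
    by simp_all
  ultimately show "\<exists>p q. p \<noteq> q \<and> e = {p, q}" by blast
qed

interpretation full: simple_edges "edges n"
proof
  fix e assume "e \<in> edges n"
  then obtain x y where "e \<in> {{(x, y), (x + 1, y)}, {(x, y), (x, y + 1)}, {(x, y), (x + 1, y + 1)}}"
    unfolding edges_def horizontal_edges_def vertical_edges_def diagonal_edges_def by blast
  moreover have "(x, y) \<noteq> (x + 1, y)" "(x, y) \<noteq> (x, y + 1)" "(x, y) \<noteq> (x + 1, y + 1)"
    by simp_all
  ultimately show "\<exists>p q. p \<noteq> q \<and> e = {p, q}" by blast
qed

text \<open>In stage \<open>(s, x)\<close> the columns from \<open>x\<close> on reach down to height \<open>2s\<close> above the diagonal, the
  columns before \<open>x\<close> only to height \<open>2s + 2\<close>. The lowest vertices always have even coordinate sum.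
  Only \<open>c\<close> columns are present. Column \<open>2n\<close> (for \<open>c = 2n + 1\<close>) is given the vertex \<open>(2n, 2n)\<close>
  alone; the vertex \<open>(2n, 2n + 1)\<close> of \<open>G\<^sub>n\<close> for even \<open>n\<close> is treated separately.\<close>

definition column_bottom :: "nat \<Rightarrow> nat \<Rightarrow> nat \<Rightarrow> nat" where
  "column_bottom s x a = (if x \<le> a then a + 2 * s else a + 2 * s + 2)"

definition region :: "nat \<Rightarrow> nat \<Rightarrow> nat \<Rightarrow> nat \<Rightarrow> vertex set" where
  "region n c s x = {(int a, int b) | a b.
     a < c \<and> column_bottom s x a \<le> b \<and> b \<le> 2 * n + 1 \<and> \<not> (a = 2 * n \<and> b = 2 * n + 1)}"

definition frontier :: "nat \<Rightarrow> nat \<Rightarrow> nat \<Rightarrow> nat \<Rightarrow> nat set" where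
  "frontier n c s x = {a. a < c \<and> column_bottom s x a \<le> 2 * n + 1}"

definition frontier_vertex :: "nat \<Rightarrow> nat \<Rightarrow> nat \<Rightarrow> vertex" where
  "frontier_vertex s x a = (int a, int (column_bottom s x a))"

definition region_form :: "nat \<Rightarrow> nat \<Rightarrow> nat \<Rightarrow> nat \<Rightarrow> form" where
  "region_form n c s x =
     removal_form (lattice_edges n) (region n c s x) (frontier n c s x) (frontier_vertex s x)"

lemma region_iff:
  "(a, b) \<in> region n c s x \<longleftrightarrow> 0 \<le> a \<and> a < int c \<and> int (column_bottom s x (nat a)) \<le> b \<and>
     b \<le> 2 * int n + 1 \<and> \<not> (a = 2 * int n \<and> b = 2 * int n + 1)"
proof
  assume "0 \<le> a \<and> a < int c \<and> int (column_bottom s x (nat a)) \<le> b \<and>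
     b \<le> 2 * int n + 1 \<and> \<not> (a = 2 * int n \<and> b = 2 * int n + 1)"
  then show "(a, b) \<in> region n c s x"
    unfolding region_def mem_Collect_eq
    by (intro exI[of _ "nat a"] exI[of _ "nat b"]) auto
qed (auto simp: region_def)

lemma finite_region: "finite (region n c s x)"
proof (rule finite_subset)
  show "region n c s x \<subseteq> (\<lambda>(a, b). (int a, int b)) ` ({..<c} \<times> {..2 * n + 1})"
    by (auto simp: region_def)
qed simp

lemma inj_frontier_vertex: "inj_on (frontier_vertex s x) A"
  by (auto simp: inj_on_def frontier_vertex_def)

lemma frontier_vertex_in_region:
  assumes "c \<le> 2 * n \<or> s = 0 \<and> x \<le> 2 * n"
  shows "frontier_vertex s x ` frontier n c s x \<subseteq> region n c s x"
  using assms by (auto simp: frontier_vertex_def frontier_def region_iff column_bottom_def)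

lemma removal_form_cong:
  assumes "\<And>i. i \<in> I \<Longrightarrow> f i = h i"
  shows "removal_form E U I f = removal_form E U I h"
proof
  fix S
  have "f ` S = h ` S" if "S \<subseteq> I" using assms that by (intro image_cong) auto
  then show "removal_form E U I f S = removal_form E U I h S" by (simp add: removal_form_def)
qed

text \<open>Going from stage \<open>(s, k + 1)\<close> to \<open>(s, k)\<close> adds the vertices \<open>(k, k + 2s)\<close> and
  \<open>(k, k + 2s + 1)\<close>. The first has even coordinate sum, hence no edge to the right, and column
  \<open>k - 1\<close> does not reach down to it; the second has an edge to the right, to the lowest vertex of
  column \<open>k + 1\<close>.\<close>

lemma region_form_hop:
  assumes "k + 2 * s \<le> 2 * n" "k < 2 * n" "k < c" "c \<le> 2 * n \<or> s = 0 \<and> c \<le> 2 * n + 1"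
  shows "region_form n c s k = hop k (region_form n c s (Suc k))"
proof -
  have parity: "int n mod 2 \<le> 1" by simp
  let ?x = "(int k, int k + 2 * int s)" and ?y = "(int k, int k + 2 * int s + 1)"
  let ?U = "region n c s (Suc k)" and ?I = "frontier n c s (Suc k)" and ?f = "frontier_vertex s (Suc k)"
  have "removal_form (lattice_edges n) (insert ?x (insert ?y ?U)) (insert k ?I) (?f(k := ?x))
      = hop k (removal_form (lattice_edges n) ?U ?I ?f)"
  proof (rule lattice.removal_form_hop)
    show "?f ` ?I \<subseteq> ?U" using assms by (intro frontier_vertex_in_region) auto
    show "?x \<notin> ?U" "?y \<notin> ?U" by (auto simp: region_iff column_bottom_def)
    show "{?x, ?y} \<in> lattice_edges n"
      using assms parity by (intro vertical_edgeI) auto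
    have x: "(int k + (int k + 2 * int s)) mod 2 = 0" and
      y: "(int k + (int k + 2 * int s + 1)) mod 2 = 1" by presburger+
    show "{?x, w} \<notin> lattice_edges n" if "w \<in> ?U" for w
      using even_neighbour[OF _ x, of w n] that by (auto simp: region_iff column_bottom_def split: if_splits)
    show "{?y, w} \<in> lattice_edges n \<longleftrightarrow> w \<in> ?f ` (?I \<inter> {k, Suc k})" if "w \<in> ?U" for w
    proof
      assume "{?y, w} \<in> lattice_edges n"
      from odd_neighbour[OF this y] that
      have "w = ?f k \<and> k \<in> ?I \<or> w = ?f (Suc k) \<and> Suc k \<in> ?I"
        using assms by (auto simp: region_iff column_bottom_def frontier_def frontier_vertex_def split: if_splits)
      then show "w \<in> ?f ` (?I \<inter> {k, Suc k})" by blast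
    next
      assume "w \<in> ?f ` (?I \<inter> {k, Suc k})"
      then consider "k \<in> ?I" "w = (int k, int k + 2 * int s + 1 + 1)" |
          "Suc k \<in> ?I" "w = (int k + 1, int k + 2 * int s + 1)"
        by (auto simp: frontier_vertex_def column_bottom_def)
      then show "{?y, w} \<in> lattice_edges n"
      proof cases
        case 1
        then have "k + 2 * s + 2 \<le> 2 * n + 1" by (simp add: frontier_def column_bottom_def)
        then show ?thesis
          unfolding 1 using assms(2) parity by (intro vertical_edgeI) auto
      next
        case 2
        show ?thesis
          unfolding 2 using assms(1,2) y by (intro horizontal_edgeI) auto
      qed
    qed
  qed (auto simp: finite_region inj_frontier_vertex)
  moreover have "insert ?x (insert ?y ?U) = region n c s k"
    using assms by (auto simp: region_iff column_bottom_def split: if_splits)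
  moreover have "insert k ?I = frontier n c s k"
    using assms by (auto simp: frontier_def column_bottom_def)
  moreover have "?f(k := ?x) = frontier_vertex s k"
    by (auto simp: frontier_vertex_def column_bottom_def)
  ultimately show ?thesis by (simp add: region_form_def)
qed

lemma sweep_region_form:
  assumes "k + 2 * s \<le> 2 * n + 1" "k \<le> 2 * n" "k \<le> c" "c \<le> 2 * n \<or> s = 0 \<and> c \<le> 2 * n + 1"
  shows "sweep k (region_form n c s k) = region_form n c s 0"
  using assms by (induction k) (simp_all add: region_form_hop[symmetric])

text \<open>A new level begins at the top vertex \<open>(k, 2n + 1)\<close> of the last column that it meets; there
  one more path starts.\<close>

lemma region_form_append:
  assumes "1 \<le> s" "s \<le> n" "k = 2 * n + 1 - 2 * s"
  shows "region_form n (2 * n) s k = append_basis k (region_form n (2 * n) (Suc s) 0)"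
proof -
  let ?x = "(int k, 2 * int n + 1)"
  let ?U = "region n (2 * n) (Suc s) 0" and ?I = "frontier n (2 * n) (Suc s) 0"
    and ?f = "frontier_vertex (Suc s) 0"
  have "removal_form (lattice_edges n) (insert ?x ?U) (insert k ?I) (?f(k := ?x))
      = append_basis k (removal_form (lattice_edges n) ?U ?I ?f)"
  proof (rule lattice.removal_form_append)
    show "?f ` ?I \<subseteq> ?U" by (intro frontier_vertex_in_region) auto
    show "?x \<notin> ?U" using assms by (auto simp: region_iff column_bottom_def)
    show "k \<notin> ?I" using assms by (auto simp: frontier_def column_bottom_def)
    have "(int k + (2 * int n + 1)) mod 2 = 0" using assms by presburger
    then show "{?x, w} \<notin> lattice_edges n" if "w \<in> ?U" for w
      using even_neighbour[of "int k" "2 * int n + 1" w n] that assms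
      by (auto simp: region_iff column_bottom_def split: if_splits)
  qed (auto simp: finite_region inj_frontier_vertex)
  moreover have "insert ?x ?U = region n (2 * n) s k"
    using assms by (auto simp: region_iff column_bottom_def split: if_splits)
  moreover have "insert k ?I = frontier n (2 * n) s k"
    using assms by (auto simp: frontier_def column_bottom_def split: if_splits)
  moreover have "removal_form E U (frontier n (2 * n) s k) (?f(k := ?x)) =
      removal_form E U (frontier n (2 * n) s k) (frontier_vertex s k)" for E U
    by (rule removal_form_cong) (use assms in \<open>auto simp: frontier_def frontier_vertex_def column_bottom_def split: if_splits\<close>)
  ultimately show ?thesis by (simp add: region_form_def)
qed

text \<open>On the last level the vertex \<open>(2n, 2n)\<close> starts a path if it is present.\<close>

lemma region_form_corner:
  "region_form n (2 * n + 1) 0 (2 * n) = append_basis (2 * n) (region_form n (2 * n) 1 0)"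
proof -
  let ?x = "(2 * int n, 2 * int n)"
  let ?U = "region n (2 * n) 1 0" and ?I = "frontier n (2 * n) 1 0" and ?f = "frontier_vertex 1 0"
  have "removal_form (lattice_edges n) (insert ?x ?U) (insert (2 * n) ?I) (?f(2 * n := ?x))
      = append_basis (2 * n) (removal_form (lattice_edges n) ?U ?I ?f)"
  proof (rule lattice.removal_form_append)
    show "?f ` ?I \<subseteq> ?U" by (intro frontier_vertex_in_region) auto
    show "{?x, w} \<notin> lattice_edges n" if "w \<in> ?U" for w
      using even_neighbour[of "2 * int n" "2 * int n" w n] that
      by (auto simp: region_iff column_bottom_def split: if_splits)
  qed (auto simp: finite_region inj_frontier_vertex region_iff frontier_def)
  moreover have "insert ?x ?U = region n (2 * n + 1) 0 (2 * n)"
    by (auto simp: region_iff column_bottom_def split: if_splits)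
  moreover have "insert (2 * n) ?I = frontier n (2 * n + 1) 0 (2 * n)"
    by (auto simp: frontier_def column_bottom_def split: if_splits)
  moreover have "removal_form E U (frontier n (2 * n + 1) 0 (2 * n)) (?f(2 * n := ?x)) =
      removal_form E U (frontier n (2 * n + 1) 0 (2 * n)) (frontier_vertex 0 (2 * n))" for E U
    by (rule removal_form_cong) (auto simp: frontier_def frontier_vertex_def column_bottom_def split: if_splits)
  ultimately show ?thesis by (simp add: region_form_def)
qed

lemma region_form_no_corner:
  "region_form n (2 * n) 0 (2 * n) = region_form n (2 * n) 1 0"
proof -
  have "region n (2 * n) 0 (2 * n) = region n (2 * n) 1 0"
    by (auto simp: region_iff column_bottom_def split: if_splits)
  moreover have "frontier n (2 * n) 0 (2 * n) = frontier n (2 * n) 1 0"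
    by (auto simp: frontier_def column_bottom_def split: if_splits)
  moreover have "removal_form E U (frontier n (2 * n) 1 0) (frontier_vertex 0 (2 * n)) =
      removal_form E U (frontier n (2 * n) 1 0) (frontier_vertex 1 0)" for E U
    by (rule removal_form_cong) (auto simp: frontier_def frontier_vertex_def column_bottom_def)
  ultimately show ?thesis by (simp add: region_form_def)
qed

lemma region_form_empty: "region_form n (2 * n) (Suc n) 0 = unit_form"
proof -
  have "region n (2 * n) (Suc n) 0 = {}" by (auto simp: region_iff column_bottom_def)
  moreover have "frontier n (2 * n) (Suc n) 0 = {}" by (auto simp: frontier_def column_bottom_def)
  moreover have "{} \<notin> lattice_edges n"
    by (auto simp: lattice_edges_def horizontal_edges_def vertical_edges_def)
  ultimately show ?thesis
    by (auto simp: fun_eq_iff region_form_def removal_form_def unit_form_def matching_count_empty)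
qed

section \<open>The form of the graph without diagonal edges\<close>

text \<open>The number of lattice paths that start in column \<open>k\<close> and end in column \<open>x\<close>, with \<open>k - x\<close>
  steps to the left and \<open>t\<close> steps down.\<close>

definition path_count :: "nat \<Rightarrow> nat \<Rightarrow> nat \<Rightarrow> real" where
  "path_count t k x = (if x \<le> k then real ((k - x + t) choose t) else 0)"

lemma sum_path_count:
  assumes "y \<le> k"
  shows "(\<Sum>x=y..k. path_count t k x) = path_count (Suc t) k y"
proof -
  have "(\<Sum>x=y..k. path_count t k x) = (\<Sum>i\<le>k - y. path_count t k (k - i))"
    by (rule sum.reindex_bij_witness[of _ "\<lambda>i. k - i" "\<lambda>x. k - x"]) (use assms in auto)
  also have "\<dots> = real (\<Sum>i\<le>k - y. (i + t) choose t)"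
    unfolding of_nat_sum by (intro sum.cong refl) (simp add: path_count_def)
  also have "(\<Sum>i\<le>k - y. (i + t) choose t) = Suc (k - y + t) choose Suc t"
    using choose_rising_sum(1)[of t "k - y"] by (simp add: ac_simps)
  finally show ?thesis using assms by (simp add: path_count_def)
qed

lemma covector_sweep_path_count:
  assumes "k' \<le> k"
  shows "covector_sweep k (path_count t k') = path_count (Suc t) k'"
proof
  fix y
  show "covector_sweep k (path_count t k') y = path_count (Suc t) k' y"
  proof (cases "y \<le> k'")
    case True
    have "(\<Sum>x=y..k. path_count t k' x) = (\<Sum>x=y..k'. path_count t k' x)"
      using assms by (intro sum.mono_neutral_right) (auto simp: path_count_def)
    with True assms show ?thesis by (simp add: covector_sweep_eq sum_path_count)
  next
    case False
    then have "(\<Sum>x=y..k. path_count t k' x) = 0"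
      by (intro sum.neutral) (auto simp: path_count_def)
    with False show ?thesis by (simp add: covector_sweep_eq) (simp add: path_count_def)
  qed
qed

lemma covector_sweep_indicator:
  "covector_sweep k (\<lambda>x. if x = k then 1 else 0) = path_count 0 k"
  by (auto simp: fun_eq_iff covector_sweep_eq path_count_def)

text \<open>After \<open>i\<close> levels there are \<open>i\<close> factors, the \<open>j\<close>-th one created in column \<open>2j + 1\<close> and swept
  \<open>i - j\<close> times; the first sweep turned it from a basis covector into the indicator of the
  columns up to its own. A new start column
  lies to the right of all supports, so its covector can be appended behind the existing factors.\<close>

lemma region_form_wedges:
  "i \<le> n \<Longrightarrow> region_form n (2 * n) (Suc n - i) 0 =
     wedges (2 * n) (map (\<lambda>j. path_count (i - Suc j) (2 * j + 1)) [0..<i]) unit_form"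
proof (induction i)
  case 0
  show ?case by (simp add: region_form_empty)
next
  case (Suc i)
  define k where "k = 2 * i + 1"
  have k: "k \<le> 2 * n" "k = 2 * n + 1 - 2 * (n - i)" using Suc.prems by (auto simp: k_def)
  let ?vs = "map (\<lambda>j. path_count (i - Suc j) (2 * j + 1)) [0..<i]"
  have "region_form n (2 * n) (n - i) 0 = sweep k (region_form n (2 * n) (n - i) k)"
    using Suc.prems by (subst sweep_region_form) (auto simp: k_def)
  also have "region_form n (2 * n) (n - i) k = append_basis k (region_form n (2 * n) (Suc n - i) 0)"
    using Suc.prems k by (subst region_form_append) (auto simp: Suc_diff_le)
  also have "\<dots> = append_basis k (wedges (2 * n) ?vs unit_form)"
    using Suc by simp
  also have "\<dots> = wedges (2 * n) ?vs (append_basis k unit_form)"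
    by (intro append_basis_wedges) (auto simp: path_count_def k_def)
  also have "sweep k \<dots> = wedges (2 * n)
      (map (covector_sweep k) (?vs @ [\<lambda>x. if x = k then 1 else 0])) unit_form"
    using k(1) by (simp add: append_basis_unit_form[of k "2 * n"] sweep_wedges sweep_wedge)
  also have "map (covector_sweep k) (?vs @ [\<lambda>x. if x = k then 1 else 0]) =
      map (\<lambda>j. path_count (Suc i - Suc j) (2 * j + 1)) [0..<Suc i]"
  proof -
    have "covector_sweep k (path_count (i - Suc j) (2 * j + 1)) = path_count (i - j) (2 * j + 1)"
      if "j < i" for j
      using that covector_sweep_path_count[of "2 * j + 1" k "i - Suc j"]
      by (simp add: k_def Suc_diff_Suc del: covector_sweep.simps)
    then show ?thesis
      by (simp add: covector_sweep_indicator k_def del: covector_sweep.simps)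
  qed
  finally show ?case by simp
qed

text \<open>The path counts on the diagonal as a single binomial coefficient. With truncated subtraction
  it vanishes by itself for \<open>2j + 1 < x\<close> as long as \<open>j < n\<close>, and for \<open>j = n\<close> it is constantly \<open>1\<close>.\<close>

definition path_covector :: "nat \<Rightarrow> nat \<Rightarrow> nat \<Rightarrow> real" where
  "path_covector n j x = real ((n + 1 + j - x) choose (n - j))"

lemma path_covector_eq: "j < n \<Longrightarrow> path_covector n j = path_count (n - j) (2 * j + 1)"
  by (auto simp: fun_eq_iff path_covector_def path_count_def binomial_eq_0 ac_simps)

lemma sweep_above_diagonal:
  "sweep (2 * n) (region_form n (2 * n) 1 0) = wedges (2 * n) (map (path_covector n) [0..<n]) unit_form"
proof -
  have "sweep (2 * n) (region_form n (2 * n) 1 0) = wedges (2 * n)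
    (map (covector_sweep (2 * n)) (map (\<lambda>j. path_count (n - Suc j) (2 * j + 1)) [0..<n])) unit_form"
    using region_form_wedges[of n n] by (simp add: sweep_wedges)
  also have "map (covector_sweep (2 * n)) (map (\<lambda>j. path_count (n - Suc j) (2 * j + 1)) [0..<n]) =
      map (path_covector n) [0..<n]"
    by (auto simp: covector_sweep_path_count path_covector_eq Suc_diff_Suc)
  finally show ?thesis .
qed

definition start_form :: "nat \<Rightarrow> nat \<Rightarrow> form" where
  "start_form n m = wedges (2 * n) (map (path_covector n) [0..<m]) unit_form"

lemma region_form_no_corner_eq: "region_form n (2 * n) 0 0 = start_form n n"
  using sweep_region_form[of "2 * n" 0 n "2 * n"] sweep_above_diagonal[of n]
  by (simp add: region_form_no_corner start_form_def)

lemma region_form_corner_eq: "region_form n (2 * n + 1) 0 0 = start_form n (n + 1)"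
proof -
  have "region_form n (2 * n + 1) 0 0 = sweep (2 * n) (append_basis (2 * n) (region_form n (2 * n) 1 0))"
    using sweep_region_form[of "2 * n" 0 n "2 * n + 1"] region_form_corner[of n] by simp
  also have "append_basis (2 * n) (region_form n (2 * n) 1 0) =
      wedges (2 * n) (map (\<lambda>j. path_count (n - Suc j) (2 * j + 1)) [0..<n]) (append_basis (2 * n) unit_form)"
    using region_form_wedges[of n n] by (simp, intro append_basis_wedges) (auto simp: path_count_def)
  also have "sweep (2 * n) \<dots> = wedges (2 * n) (map (path_covector n) [0..<n])
      (wedge (2 * n) (path_count 0 (2 * n)) unit_form)"
  proof -
    have "map (covector_sweep (2 * n)) (map (\<lambda>j. path_count (n - Suc j) (2 * j + 1)) [0..<n]) =
      map (path_covector n) [0..<n]"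
      by (auto simp: covector_sweep_path_count path_covector_eq Suc_diff_Suc)
    then show ?thesis
      by (simp only: append_basis_unit_form[OF order_refl] sweep_wedges[OF order_refl]
          sweep_wedge[OF order_refl] covector_sweep_indicator sweep_unit_form)
  qed
  also have "wedge (2 * n) (path_count 0 (2 * n)) = wedge (2 * n) (path_covector n n)"
    by (intro wedge_cong) (simp add: path_count_def path_covector_def)
  finally show ?thesis by (simp add: start_form_def)
qed

lemma frontier_full: "c \<le> 2 * n + 1 \<Longrightarrow> frontier n c 0 0 = {..<c}"
  by (auto simp: frontier_def column_bottom_def)

section \<open>The form of the full graph\<close>

text \<open>The diagonal edges are inserted one at a time. When column \<open>2n\<close> is absent the last of them
  joins no two vertices of the region, and \<open>pair_up\<close> then changes nothing either.\<close>

lemma removal_form_diagonal: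
  assumes "c \<le> 2 * n + 1" "k \<le> 2 * n"
  shows "removal_form (lattice_edges n \<union> {{(int x, int x), (int x + 1, int x + 1)} | x. x < k})
      (region n c 0 0) {..<c} (\<lambda>a. (int a, int a)) = pair_range 0 k (region_form n c 0 0)"
  using assms(2)
proof (induction k)
  case 0
  have "frontier_vertex 0 0 = (\<lambda>a. (int a, int a))" by (auto simp: frontier_vertex_def column_bottom_def)
  then show ?case using frontier_full[OF assms(1)] by (simp add: region_form_def)
next
  case (Suc k)
  let ?E = "\<lambda>k. lattice_edges n \<union> {{(int x, int x), (int x + 1, int x + 1)} | x. x < k}"
  let ?f = "\<lambda>a. (int a, int a)"
  have E: "?E (Suc k) = insert {?f k, ?f (Suc k)} (?E k)"
    by (auto simp: less_Suc_eq)
  have "{?f k, ?f (Suc k)} \<notin> ?E k"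
    using even_neighbour[of "int k" "int k" "?f (Suc k)" n] by (auto simp: doubleton_eq_iff)
  then have "removal_form (insert {?f k, ?f (Suc k)} (?E k)) (region n c 0 0) {..<c} ?f =
      pair_up k (removal_form (?E k) (region n c 0 0) {..<c} ?f)"
    using assms(1) Suc.prems
    by (intro removal_form_pair_up) (auto simp: finite_region inj_on_def region_iff column_bottom_def)
  also have "\<dots> = pair_up k (pair_range 0 k (region_form n c 0 0))"
    using Suc by simp
  finally show ?case unfolding E by simp
qed

lemma matching_count_region:
  assumes "c \<le> 2 * n + 1" "S \<subseteq> {..<c}"
  shows "real (matching_count (edges n) (region n c 0 0 - (\<lambda>a. (int a, int a)) ` S)) =
    pair_range 0 (2 * n) (region_form n c 0 0) S"
proof -
  have "{{(int x, int x), (int x + 1, int x + 1)} | x. x < 2 * n} = diagonal_edges n"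
    unfolding diagonal_edges_def
  proof safe
    fix x :: int assume "0 \<le> x" "x \<le> 2 * int n - 1"
    then show "\<exists>y. {(x, x), (x + 1, x + 1)} = {(int y, int y), (int y + 1, int y + 1)} \<and> y < 2 * n"
      by (intro exI[of _ "nat x"]) auto
  next
    fix x assume "x < 2 * n"
    then show "\<exists>y. {(int x, int x), (int x + 1, int x + 1)} = {(y, y), (y + 1, y + 1)} \<and>
        0 \<le> y \<and> y \<le> 2 * int n - 1"
      by (intro exI[of _ "int x"]) auto
  qed
  then have "lattice_edges n \<union> {{(int x, int x), (int x + 1, int x + 1)} | x. x < 2 * n} = edges n"
    by (simp add: edges_def lattice_edges_def)
  with fun_cong[OF removal_form_diagonal[OF assms(1) order_refl], of S] assms(2) show ?thesis
    by (simp add: removal_form_def)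
qed

definition paired_form :: "nat \<Rightarrow> nat \<Rightarrow> form" where
  "paired_form n m = pair_range 0 (2 * n) (start_form n m)"

text \<open>The number of paths in \<open>G\<^sub>n\<close> without and with removal of \<open>b\<close>. The first is even, as
  the ends of the paths are joined in pairs by diagonal edges; the second is odd, as one more
  vertex is removed from the diagonal.\<close>

definition starts :: "nat \<Rightarrow> nat" where
  "starts n = (if even n then n else n + 1)"

definition starts_b :: "nat \<Rightarrow> nat" where
  "starts_b n = (if even n then n + 1 else n)"

lemma Z_del_eq_matching_count: "Z_del n S = matching_count (edges n) (vertices n - S)"
  by (simp add: Z_del_def matching_count_def)

lemma vertices_eq: "vertices n = region n (2 * n + 1) 0 0 \<union> (if even n then {(2 * int n, 2 * int n + 1)} else {})"
  by (auto simp: vertices_def region_iff column_bottom_def)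

lemma region_remove_corner: "region n (2 * n + 1) 0 0 - {(2 * int n, 2 * int n)} = region n (2 * n) 0 0"
  by (auto simp: region_iff column_bottom_def)

lemma neighbour_of_top_corner:
  assumes "{(2 * int n, 2 * int n + 1), w} \<in> edges n"
  shows "w = (2 * int n, 2 * int n)"
proof -
  have "{(2 * int n, 2 * int n + 1), w} \<notin> diagonal_edges n"
    by (auto simp: diagonal_edges_def doubleton_eq_iff)
  with assms have "{(2 * int n, 2 * int n + 1), w} \<in> lattice_edges n"
    by (simp add: edges_def lattice_edges_def)
  then show ?thesis
    using odd_neighbour[of "2 * int n" "2 * int n + 1" w n]
      lattice_edge_range[of "{(2 * int n, 2 * int n + 1), w}" n w] by force
qed

text \<open>For even \<open>n\<close> the vertex \<open>(2n, 2n + 1)\<close> is a leaf, and removing it together with its neighbour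
  \<open>(2n, 2n)\<close> leaves the region with \<open>2n\<close> columns.\<close>

lemma Z_del_diagonal:
  assumes "S \<subseteq> {..<2 * n}"
  shows "real (Z_del n ((\<lambda>a. (int a, int a)) ` S)) = paired_form n (starts n) S"
proof (cases "even n")
  case False
  have "S \<subseteq> {..<2 * n + 1}" using assms by auto
  with False show ?thesis
    using matching_count_region[OF order_refl, of S n, unfolded region_form_corner_eq]
    by (simp add: Z_del_eq_matching_count vertices_eq paired_form_def starts_def)
next
  case True
  let ?b = "(2 * int n, 2 * int n + 1)" and ?d = "(2 * int n, 2 * int n)"
  let ?D = "(\<lambda>a. (int a, int a)) ` S"
  let ?U = "vertices n - ?D"
  have "matching_count (edges n) ?U = matching_count (edges n) (?U - {?b, ?d})"
  proof (rule full.matching_count_leaf)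
    show "finite ?U" by (simp add: vertices_eq finite_region)
    show "?b \<in> ?U" "?d \<in> ?U" using True assms by (auto simp: vertices_eq region_iff column_bottom_def)
    have "{?d, ?b} \<in> lattice_edges n" using True by (intro vertical_edgeI) (auto elim!: evenE)
    then show "{?b, ?d} \<in> edges n"
      by (simp add: lattice_edges_def edges_def insert_commute)
  qed (use neighbour_of_top_corner in auto)
  also have "?U - {?b, ?d} = region n (2 * n) 0 0 - ?D"
    using region_remove_corner[of n] True by (auto simp: vertices_eq region_iff)
  finally show ?thesis
    using matching_count_region[of "2 * n" n S] assms True
    by (simp add: Z_del_eq_matching_count paired_form_def region_form_no_corner_eq starts_def)
qed

text \<open>For odd \<open>n\<close> the vertex \<open>b\<close> is \<open>(2n, 2n)\<close>, whose removal deletes column \<open>2n\<close>; for even \<open>n\<close>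
  it is the leaf \<open>(2n, 2n + 1)\<close>, whose removal leaves \<open>(2n, 2n)\<close> in place.\<close>

lemma Z_del_diagonal_b:
  assumes "S \<subseteq> {..<2 * n}"
  shows "real (Z_del n (insert (b_vertex n) ((\<lambda>a. (int a, int a)) ` S))) =
    paired_form n (starts_b n) S"
proof (cases "even n")
  case True
  then have "vertices n - insert (b_vertex n) ((\<lambda>a. (int a, int a)) ` S) =
      region n (2 * n + 1) 0 0 - (\<lambda>a. (int a, int a)) ` S"
    by (auto simp: vertices_eq region_iff b_vertex_def elim!: evenE)
  moreover have "S \<subseteq> {..<2 * n + 1}" using assms by auto
  ultimately show ?thesis
    using matching_count_region[OF order_refl, of S n, unfolded region_form_corner_eq] True
    by (simp add: Z_del_eq_matching_count paired_form_def starts_b_def)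
next
  case False
  then have "b_vertex n = (2 * int n, 2 * int n)" by (auto simp: b_vertex_def elim!: oddE)
  then have "vertices n - insert (b_vertex n) ((\<lambda>a. (int a, int a)) ` S) =
      region n (2 * n) 0 0 - (\<lambda>a. (int a, int a)) ` S"
    using False by (auto simp: vertices_eq simp flip: region_remove_corner)
  then show ?thesis
    using matching_count_region[of "2 * n" n S] assms False
    by (simp add: Z_del_eq_matching_count paired_form_def region_form_no_corner_eq starts_b_def)
qed

lemma edge_subset_vertices:
  assumes "e \<in> edges n"
  shows "e \<subseteq> vertices n"
proof -
  have "e \<subseteq> vertices n" if "e \<in> horizontal_edges n"
  proof -
    from that obtain x y where e: "e = {(x, y), (x + 1, y)}" "0 \<le> x" "x \<le> 2 * int n - 1"
      "x \<le> y" "y \<le> 2 * int n + 1" "(x + y) mod 2 = 1"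
      unfolding horizontal_edges_def by blast
    moreover have "x \<noteq> y" "\<not> (x = 2 * int n - 1 \<and> y = 2 * int n + 1)"
      using e(6) by presburger+
    ultimately show ?thesis by (auto simp: vertices_def)
  qed
  moreover have "e \<subseteq> vertices n" if "e \<in> vertical_edges n"
  proof -
    from that obtain x y where e: "e = {(x, y), (x, y + 1)}" "0 \<le> x"
      "x \<le> 2 * int n - int n mod 2" "x \<le> y" "y \<le> 2 * int n"
      unfolding vertical_edges_def by blast
    moreover have "x < 2 * int n" if "odd n"
      using e(3) that by presburger
    ultimately show ?thesis by (auto simp: vertices_def)
  qed
  moreover have "e \<subseteq> vertices n" if "e \<in> diagonal_edges n"
    using that by (auto simp: diagonal_edges_def vertices_def)
  ultimately show ?thesis using assms unfolding edges_def by blast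
qed

lemma Z_eq_paired_form: "real (Z n) = paired_form n (starts n) {}"
proof -
  have "induced_edges (vertices n) (edges n) = edges n"
    using edge_subset_vertices by (auto simp: induced_edges_def)
  then have "Z n = Z_del n {}" by (simp add: Z_def Z_del_def)
  then show ?thesis using Z_del_diagonal[of "{}" n] by simp
qed

section \<open>Three properties of the path covectors\<close>

text \<open>The \<open>m\<close>-th backward difference of \<open>a \<mapsto> (a choose d)\<close>, obtained by \<open>m\<close> applications of Pascal's
  rule. The hypothesis \<open>m \<le> a\<close> keeps all arguments inside the range where the truncated
  difference is the true one.\<close>

lemma alternating_binomial_sum:
  assumes "m \<le> a"
  shows "(\<Sum>x\<le>m. (- 1) ^ x * real (m choose x) * real ((a - x) choose d)) =
    (if m \<le> d then real ((a - m) choose (d - m)) else 0)"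
  using assms
proof (induction m arbitrary: a)
  case (Suc m)
  let ?T = "\<lambda>a x. (- 1) ^ x * real (m choose x) * real ((a - x) choose d)"
  have "(\<Sum>x\<le>Suc m. (- 1) ^ x * real (Suc m choose x) * real ((a - x) choose d)) =
      real (a choose d) + (\<Sum>x\<le>m. ?T a (Suc x) - ?T (a - 1) x)"
  proof -
    have "(- 1) ^ Suc x * real (Suc m choose Suc x) * real ((a - Suc x) choose d) =
        ?T a (Suc x) - ?T (a - 1) x" for x
      by (simp add: algebra_simps)
    then show ?thesis by (subst sum.atMost_Suc_shift) simp
  qed
  also have "\<dots> = (real (a choose d) + (\<Sum>x\<le>m. ?T a (Suc x))) - (\<Sum>x\<le>m. ?T (a - 1) x)"
    by (simp add: sum_subtractf)
  also have "real (a choose d) + (\<Sum>x\<le>m. ?T a (Suc x)) = (\<Sum>x\<le>Suc m. ?T a x)"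
    by (subst sum.atMost_Suc_shift) simp
  also have "\<dots> = (\<Sum>x\<le>m. ?T a x)" by simp
  also have "(\<Sum>x\<le>m. ?T a x) - (\<Sum>x\<le>m. ?T (a - 1) x) =
      (if m \<le> d then real ((a - m) choose (d - m)) - real ((a - 1 - m) choose (d - m)) else 0)"
    using Suc.prems by (simp only: Suc.IH[of a] Suc.IH[of "a - 1"]) auto
  also have "\<dots> = (if Suc m \<le> d then real ((a - Suc m) choose (d - Suc m)) else 0)"
  proof (cases "Suc m \<le> d")
    case True
    moreover obtain b where "a - m = Suc b" "a - 1 - m = b" "a - Suc m = b"
      using Suc.prems by (cases "a - m") auto
    moreover obtain e where "d - m = Suc e" "d - Suc m = e"
      using True by (cases "d - m") auto
    ultimately show ?thesis by simp
  next
    case False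
    then show ?thesis by (auto simp: le_Suc_eq not_less_eq_eq)
  qed
  finally show ?case .
qed simp

text \<open>The order \<open>n + 1\<close> of the difference exceeds the degree \<open>n - j\<close> of the polynomial.\<close>

lemma path_covector_relation:
  assumes "j \<le> n"
  shows "(\<Sum>x\<le>n + 1. ((- 1) ^ x * real ((n + 1) choose x)) * path_covector n j x) = 0"
  using alternating_binomial_sum[of "n + 1" "n + 1 + j" "n - j"]
  by (simp add: path_covector_def)

text \<open>The antisymmetric extension of the values at two-element sets, matching the sign convention
  of \<open>g\<close>.\<close>

definition pair_value :: "form \<Rightarrow> nat \<Rightarrow> nat \<Rightarrow> real" where
  "pair_value \<psi> i j = contract j (contract i \<psi>) {}"

lemma contract_empty: "contract j \<psi> {} = \<psi> {j}"
  by (simp add: contract_def)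

lemma pair_value_eq:
  "pair_value \<psi> i j = (if i < j then \<psi> {i, j} else if j < i then - \<psi> {j, i} else 0)"
  unfolding pair_value_def
proof -
  have "{y. (y = i \<or> y = j) \<and> y < i} = (if j < i then {j} else {})" by auto
  moreover have "{y. y = j \<and> y < i} = (if j < i then {j} else {})" by auto
  ultimately show "contract j (contract i \<psi>) {} =
      (if i < j then \<psi> {i, j} else if j < i then - \<psi> {j, i} else 0)"
    by (auto simp: contract_def rank_sign_def insert_commute)
qed

text \<open>The last covector is constantly \<open>1\<close>. It is moved to the front at the price of the sign
  \<open>(-1)\<^sup>n\<close>, its defect telescopes to the contractions with \<open>e\<^bsub>2n\<^esub>\<close> and \<open>- e\<^sub>0\<close>, and the former
  vanishes because no other path starts at or beyond column \<open>2n\<close>.\<close>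

lemma start_form_last:
  assumes "n \<ge> 1"
  shows "paired_form n (Suc n) = (\<lambda>S. (- 1) ^ n *
    (wedge (2 * n) (path_covector n n) (paired_form n n) S - contract 0 (paired_form n n) S))"
proof -
  let ?v = "path_covector n n"
  let ?\<psi> = "paired_form n n"
  have v: "?v x = 1" for x by (simp add: path_covector_def)
  have "start_form n (Suc n) = (\<lambda>S. (- 1) ^ n * wedge (2 * n) ?v (start_form n n) S)"
    by (simp add: start_form_def wedge_wedges)
  then have "paired_form n (Suc n) = (\<lambda>S. (- 1) ^ n * (wedge (2 * n) ?v ?\<psi> S
      + (\<Sum>k<2 * n. contract (Suc k) ?\<psi> S - contract k ?\<psi> S)))"
    by (simp add: paired_form_def pair_range_linear pair_range_wedge v)
  moreover have "contract (2 * n) ?\<psi> S = 0" for S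
  proof -
    have "path_covector n j (2 * n) = 0" if "j < n" for j
      using that by (simp add: path_covector_def binomial_eq_0)
    then have "(\<lambda>S. \<Sum>x\<in>{2 * n}. 1 * contract x (start_form n n) S) = (\<lambda>S. 0)"
      unfolding start_form_def by (intro contract_wedges_eq_0) auto
    then have "contract (2 * n) (start_form n n) = (\<lambda>S. 0)" by simp
    then show ?thesis by (simp add: paired_form_def contract_pair_range pair_range_linear)
  qed
  moreover have "(\<Sum>k<2 * n. contract (Suc k) ?\<psi> S - contract k ?\<psi> S) =
      contract (2 * n) ?\<psi> S - contract 0 ?\<psi> S" for S
    by (rule sum_lessThan_telescope)
  ultimately show ?thesis by simp
qed

text \<open>One of the two forms arises from the other by splitting off the constant covector; which one
  depends on the parity of \<open>n\<close>, and the resulting signs agree in both cases.\<close>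

lemma corner_relation:
  assumes "n \<ge> 1" "j < 2 * n"
  shows "pair_value (paired_form n (starts n)) 0 j + paired_form n (starts_b n) {j} =
    paired_form n (starts n) {}"
proof (cases "even n")
  case True
  let ?\<psi> = "paired_form n n"
  have "paired_form n (starts_b n) {j} = contract j (paired_form n (Suc n)) {}"
    using True by (simp add: starts_b_def contract_empty)
  also have "\<dots> = ?\<psi> {} - pair_value ?\<psi> 0 j"
    using True assms
    by (simp add: start_form_last form_linear contract_wedge pair_value_def path_covector_def)
  finally show ?thesis using True by (simp add: starts_def)
next
  case False
  let ?\<psi> = "paired_form n n"
  let ?v = "path_covector n n"
  have *: "paired_form n (starts n) = (\<lambda>S. contract 0 ?\<psi> S - wedge (2 * n) ?v ?\<psi> S)"
    using False assms(1) by (simp add: starts_def start_form_last)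
  have "pair_value (paired_form n (starts n)) 0 j = contract 0 ?\<psi> {} - contract j ?\<psi> {}"
    using assms(2)
    by (simp add: * pair_value_def form_linear contract_wedge path_covector_def)
  then show ?thesis using False by (simp add: * starts_b_def contract_empty)
qed

lemma pair_range_split:
  assumes "n \<ge> 1"
  shows "pair_range 0 (2 * n) \<phi> = pair_range 2 (2 * (n - 1)) (pair_up 1 (pair_up 0 \<phi>))"
proof -
  have "2 * n = 2 + 2 * (n - 1)" using assms by simp
  then have "pair_range 0 (2 * n) \<phi> = pair_range (0 + 2) (2 * (n - 1)) (pair_range 0 2 \<phi>)"
    by (simp only: pair_range_add)
  then show ?thesis by (simp add: numeral_2_eq_2)
qed

text \<open>The defect of \<open>v\<^sub>0\<close> contracts with \<open>w = (n+1) e\<^sub>1 + e\<^sub>2 - e\<^sub>0\<close>. Contraction with \<open>w\<close> does not see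
  the pairings of the columns \<open>0, 1\<close> and \<open>1, 2\<close>, since the two terms that they contribute cancel:
  \<open>w \<and> (e\<^sub>0 \<and> e\<^sub>1 + e\<^sub>1 \<and> e\<^sub>2) = 0\<close>. What remains are the pairings inside the columns from \<open>2\<close> on.\<close>

lemma paired_form_first:
  assumes "n \<ge> 1" "m \<ge> 1"
  defines "\<phi> \<equiv> wedges (2 * n) (map (path_covector n) [1..<m]) unit_form"
  shows "paired_form n m = (\<lambda>S. wedge (2 * n) (path_covector n 0) (pair_range 0 (2 * n) \<phi>) S +
    pair_range 2 (2 * (n - 1))
      (\<lambda>S. real (n + 1) * contract 1 \<phi> S + contract 2 \<phi> S - contract 0 \<phi> S) S)"
proof -
  let ?v = "path_covector n 0" and ?\<psi> = "pair_range 0 (2 * n) \<phi>"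
  have v: "?v 0 = real (n + 1)" "?v (Suc 0) = 1"
    by (simp_all add: path_covector_def)
  have v_ge_2: "?v (Suc (Suc x)) = 0" for x
    using assms(1) by (auto simp: path_covector_def intro!: binomial_eq_0)
  obtain k where k: "2 * n = Suc (Suc k)" using assms(1) by (cases n) auto
  have "paired_form n m = pair_range 0 (2 * n) (wedge (2 * n) ?v \<phi>)"
    using assms(2) by (simp add: paired_form_def start_form_def \<phi>_def upt_conv_Cons)
  also have "\<dots> = (\<lambda>S. wedge (2 * n) ?v ?\<psi> S +
      (\<Sum>k<2 * n. ?v k * contract (Suc k) ?\<psi> S - ?v (Suc k) * contract k ?\<psi> S))"
    by (rule pair_range_wedge) simp
  also have "\<dots> = (\<lambda>S. wedge (2 * n) ?v ?\<psi> S +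
      (real (n + 1) * contract 1 ?\<psi> S + contract 2 ?\<psi> S - contract 0 ?\<psi> S))"
    unfolding k
    by (subst sum.lessThan_Suc_shift, subst sum.lessThan_Suc_shift)
      (simp add: v v_ge_2 numeral_2_eq_2 algebra_simps)
  finally have *: "paired_form n m = \<dots>" .
  have "(\<lambda>S. real (n + 1) * contract 1 ?\<psi> S + contract 2 ?\<psi> S - contract 0 ?\<psi> S) =
      pair_range 2 (2 * (n - 1)) (\<lambda>S. real (n + 1) * contract 1 (pair_up 1 (pair_up 0 \<phi>)) S
        + contract 2 (pair_up 1 (pair_up 0 \<phi>)) S - contract 0 (pair_up 1 (pair_up 0 \<phi>)) S)"
    unfolding pair_range_split[OF assms(1)] by (simp only: contract_pair_range pair_range_linear)
  also have "(\<lambda>S. real (n + 1) * contract 1 (pair_up 1 (pair_up 0 \<phi>)) S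
        + contract 2 (pair_up 1 (pair_up 0 \<phi>)) S - contract 0 (pair_up 1 (pair_up 0 \<phi>)) S) =
      (\<lambda>S. real (n + 1) * contract 1 \<phi> S + contract 2 \<phi> S - contract 0 \<phi> S)"
  proof -
    have "contract 1 (pair_up 1 (pair_up 0 \<phi>)) = contract 1 \<phi>"
      using contract_pair_up_absorb(1)[of 1] contract_pair_up_absorb(2)[of 0] by simp
    moreover have "contract 2 (pair_up 1 (pair_up 0 \<phi>)) =
        (\<lambda>S. contract 2 \<phi> S + contract 2 (contract 1 (contract 0 \<phi>)) S)"
      using contract_pair_up_absorb(2)[of 1]
      by (simp add: numeral_2_eq_2 pair_up_eq[of 0] form_linear)
    moreover have "contract 0 (pair_up 1 (pair_up 0 \<phi>)) =
        (\<lambda>S. contract 0 \<phi> S + contract 2 (contract 1 (contract 0 \<phi>)) S)"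
      unfolding contract_pair_up[of 0 1] contract_pair_up_absorb(1)
      by (simp add: pair_up_eq numeral_2_eq_2)
    ultimately show ?thesis by (simp add: fun_eq_iff)
  qed
  finally show ?thesis using * by (simp add: fun_eq_iff)
qed

text \<open>In column \<open>x + 2\<close> the covector with number \<open>j + 1\<close> for \<open>n\<close> agrees with number \<open>j\<close> for
  \<open>n - 1\<close> in column \<open>x\<close>.\<close>

lemma shift_start:
  assumes "n \<ge> 1" "m \<ge> 1"
  shows "shift_form (wedges (2 * n) (map (path_covector n) [1..<m]) unit_form) = start_form (n - 1) (m - 1)"
proof -
  have "(\<lambda>x. path_covector n (Suc j) (x + 2)) = path_covector (n - 1) j" for j
    using assms by (auto simp: path_covector_def fun_eq_iff)
  moreover have "[1..<m] = map Suc [0..<m - 1]"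
    using assms by (simp add: map_Suc_upt)
  ultimately have *: "map (\<lambda>v x. v (x + 2)) (map (path_covector n) [1..<m]) = map (path_covector (n - 1)) [0..<m - 1]"
    by (simp add: comp_def)
  have n: "2 * n = 2 * (n - 1) + 2" using assms by simp
  show ?thesis
    unfolding start_form_def *[symmetric] by (subst n, subst shift_wedges) simp
qed

lemma shift_paired:
  assumes "n \<ge> 1" "m \<ge> 1"
  shows "pair_range 2 (2 * (n - 1)) (wedges (2 * n) (map (path_covector n) [1..<m]) unit_form) {}
     = paired_form (n - 1) (m - 1) {}"
  by (subst shift_empty[symmetric])
    (simp only: shift_pair_range shift_start[OF assms] paired_form_def)

text \<open>With \<open>w\<close> as in \<open>paired_form_first\<close>, contraction with \<open>e\<^sub>1\<close> after \<open>w\<close> cancels exactly the two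
  pairings that involve column \<open>1\<close>, so that only columns from \<open>2\<close> on take part.\<close>

lemma paired_form_at_1:
  assumes "n \<ge> 1" "m \<ge> 1"
  shows "paired_form n m {1} = paired_form (n - 1) (m - 1) {}"
proof -
  let ?\<phi> = "wedges (2 * n) (map (path_covector n) [1..<m]) unit_form"
  let ?P = "pair_range 2 (2 * (n - 1))"
  have "paired_form n m {1} = contract 1 (paired_form n m) {}"
    by (simp add: contract_empty)
  also have "\<dots> = pair_range 0 (2 * n) ?\<phi> {} +
      ?P (contract 1 (\<lambda>S. real (n + 1) * contract 1 ?\<phi> S + contract 2 ?\<phi> S - contract 0 ?\<phi> S)) {}"
    unfolding paired_form_first[OF assms] form_linear contract_pair_range
    using assms(1) by (simp add: contract_wedge path_covector_def)
  also have "\<dots> = ?P (\<lambda>S. pair_up 1 (pair_up 0 ?\<phi>) S +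
      contract 1 (\<lambda>S. real (n + 1) * contract 1 ?\<phi> S + contract 2 ?\<phi> S - contract 0 ?\<phi> S) S) {}"
    by (simp only: pair_range_split[OF assms(1)] pair_range_linear)
  also have "(\<lambda>S. pair_up 1 (pair_up 0 ?\<phi>) S +
      contract 1 (\<lambda>S. real (n + 1) * contract 1 ?\<phi> S + contract 2 ?\<phi> S - contract 0 ?\<phi> S) S) = ?\<phi>"
    by (simp add: pair_up_eq form_linear contract_contract[of 1 2] numeral_2_eq_2)
      (simp add: contract_contract[of "Suc 0" "Suc (Suc 0)"])
  also have "?P ?\<phi> {} = paired_form (n - 1) (m - 1) {}"
    by (rule shift_paired[OF assms])
  finally show ?thesis .
qed

text \<open>The difference vector replaces \<open>(n+1) e\<^sub>1 - e\<^sub>0\<close> by basis vectors with index at least \<open>2\<close>;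
  then everything takes place in the shifted copy of \<open>G\<^bsub>n-1\<^esub>\<close>.\<close>

lemma paired_form_at_ge_2:
  assumes "n \<ge> 1" "1 \<le> m" "m \<le> n + 1" "2 \<le> j" "j < 2 * n"
  defines "\<psi> \<equiv> paired_form (n - 1) (m - 1)"
  shows "paired_form n m {j} = pair_value \<psi> 0 (j - 2) +
    (\<Sum>r = 0..n - 1. (- 1) ^ r * real ((n + 1) choose (r + 2)) * pair_value \<psi> r (j - 2))"
proof -
  let ?\<phi> = "wedges (2 * n) (map (path_covector n) [1..<m]) unit_form"
  let ?P = "pair_range 2 (2 * (n - 1))"
  let ?c = "\<lambda>x. (- 1) ^ x * real ((n + 1) choose x)"
  have rel: "(\<Sum>x\<le>n + 1. ?c x * contract x ?\<phi> S) = 0" for S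
  proof -
    have "(\<lambda>S. \<Sum>x\<in>{..n + 1}. ?c x * contract x ?\<phi> S) = (\<lambda>S. 0)"
      using assms(1,3) path_covector_relation
      by (intro contract_wedges_eq_0) auto
    then show ?thesis by (rule fun_cong)
  qed
  have first: "(\<lambda>S. real (n + 1) * contract 1 ?\<phi> S + contract 2 ?\<phi> S - contract 0 ?\<phi> S) =
      (\<lambda>S. contract 2 ?\<phi> S + (\<Sum>r\<in>{0..n - 1}. ?c (r + 2) * contract (r + 2) ?\<phi> S))"
  proof
    fix S
    have "{..n + 1} = {..Suc (Suc (n - 1))}" using assms(1) by auto
    then have "0 = (\<Sum>x\<le>Suc (Suc (n - 1)). ?c x * contract x ?\<phi> S)"
      using rel[of S] by simp
    also have "\<dots> = contract 0 ?\<phi> S + (- real (n + 1) * contract 1 ?\<phi> S +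
        (\<Sum>r\<le>n - 1. ?c (r + 2) * contract (r + 2) ?\<phi> S))"
      by (subst sum.atMost_Suc_shift, subst sum.atMost_Suc_shift) simp
    finally show "real (n + 1) * contract 1 ?\<phi> S + contract 2 ?\<phi> S - contract 0 ?\<phi> S =
        contract 2 ?\<phi> S + (\<Sum>r=0..n - 1. ?c (r + 2) * contract (r + 2) ?\<phi> S)"
      by (simp add: atLeast0AtMost algebra_simps)
  qed
  let ?\<chi> = "\<lambda>S. contract 2 ?\<phi> S + (\<Sum>r=0..n - 1. ?c (r + 2) * contract (r + 2) ?\<phi> S)"
  let ?\<phi>' = "start_form (n - 1) (m - 1)"
  have "paired_form n m {j} = contract j (paired_form n m) {}"
    by (simp add: contract_empty)
  also have "\<dots> = ?P (contract j ?\<chi>) {}"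
  proof -
    have "path_covector n 0 j = 0"
      using assms(1,4) by (auto simp: path_covector_def intro!: binomial_eq_0)
    then show ?thesis
      unfolding paired_form_first[OF assms(1,2)] first form_linear contract_pair_range
      using assms(5) by (simp add: contract_wedge)
  qed
  also have "\<dots> = shift_form (?P (contract (j - 2 + 2) ?\<chi>)) {}"
  proof -
    have "j - 2 + 2 = j" using assms(4) by simp
    then show ?thesis by (simp only: shift_empty)
  qed
  also have "\<dots> = pair_range 0 (2 * (n - 1)) (contract (j - 2) (shift_form ?\<chi>)) {}"
    by (simp only: shift_pair_range shift_contract)
  also have "shift_form ?\<chi> = (\<lambda>S. contract 0 ?\<phi>' S + (\<Sum>r=0..n - 1. ?c (r + 2) * contract r ?\<phi>' S))"
  proof -
    have "shift_form (contract (r + 2) ?\<phi>) = contract r ?\<phi>'" for r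
      by (simp only: shift_contract shift_start[OF assms(1,2)])
    from this[of 0, unfolded add_0] this show ?thesis
      by (simp add: shift_form_def fun_eq_iff)
  qed
  also have "pair_range 0 (2 * (n - 1)) (contract (j - 2) \<dots>) {} = pair_value \<psi> 0 (j - 2) +
      (\<Sum>r=0..n - 1. ?c (r + 2) * pair_value \<psi> r (j - 2))"
    by (simp only: form_linear pair_range_linear pair_value_def \<psi>_def paired_form_def contract_pair_range)
  finally show ?thesis by simp
qed

lemma starts_b_bounds: "n \<ge> 1 \<Longrightarrow> 1 \<le> starts_b n" "starts_b n \<le> n + 1"
  by (auto simp: starts_b_def)

lemma starts_pred: "n \<ge> 1 \<Longrightarrow> starts (n - 1) = starts_b n - 1"
  by (auto simp: starts_def starts_b_def)

lemma Z_del_b_eq: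
  assumes "j < 2 * n"
  shows "real (Z_del n {(int j, int j), b_vertex n}) = paired_form n (starts_b n) {j}"
  using Z_del_diagonal_b[of "{j}" n] assms by (simp add: insert_commute)

section \<open>The recursion for the normalised counts\<close>

text \<open>By \<open>corner_relation\<close> at \<open>j = 1\<close>, \<open>Z\<^sub>n\<close> is \<open>Z\<^bsub>n-1\<^esub>\<close> plus a number of matchings.\<close>

lemma Z_pos: "Z n > 0"
proof (induction n)
  case 0
  have "real (Z 0) = 1"
    by (simp add: Z_eq_paired_form paired_form_def start_form_def unit_form_def starts_def)
  then show ?case by simp
next
  case (Suc n)
  let ?\<psi> = "paired_form (Suc n) (starts (Suc n))"
  have "pair_value ?\<psi> 0 1 = ?\<psi> {0, 1}" by (simp add: pair_value_eq)
  also have "\<dots> \<ge> 0"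
    using Z_del_diagonal[of "{0, 1}" "Suc n"] by (simp flip: of_nat_0_le_iff)
  finally have "real (Z (Suc n)) \<ge> paired_form (Suc n) (starts_b (Suc n)) {1}"
    using corner_relation[of "Suc n" 1] by (simp add: Z_eq_paired_form)
  also have "paired_form (Suc n) (starts_b (Suc n)) {1} = real (Z n)"
    using paired_form_at_1[of "Suc n" "starts_b (Suc n)"] starts_pred[of "Suc n"]
      starts_b_bounds(1)[of "Suc n"]
    by (simp add: Z_eq_paired_form)
  finally show ?case using Suc by simp
qed

lemma g_eq:
  assumes "i < 2 * n" "j < 2 * n"
  shows "real (Z n) * g n i j = pair_value (paired_form n (starts n)) i j"
  using Z_del_diagonal[of "{i, j}" n] Z_del_diagonal[of "{j, i}" n] assms Z_pos[of n]
  by (auto simp: g_def pair_value_eq insert_commute)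

lemma g_b_eq:
  assumes "j < 2 * n"
  shows "real (Z n) * g_b n j = paired_form n (starts_b n) {j}"
  using Z_pos[of n] Z_del_b_eq[OF assms] by (simp add: g_b_def)

lemma g_corner_relation:
  assumes "n \<ge> 1" "j < 2 * n"
  shows "g n 0 j = 1 - g_b n j"
proof -
  have "real (Z n) * g n 0 j + real (Z n) * g_b n j = real (Z n)"
  proof -
    have n: "0 < 2 * n" using assms by simp
    show ?thesis
      unfolding g_eq[OF n assms(2)] g_b_eq[OF assms(2)]
      unfolding Z_eq_paired_form
      by (rule corner_relation[OF assms])
  qed
  then have "real (Z n) * (g n 0 j + g_b n j) = real (Z n) * 1" by (simp add: algebra_simps)
  then show ?thesis using Z_pos[of n] by simp
qed

theorem theorem8p3:
  fixes n j :: nat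
  assumes "n \<ge> 1" and "j \<le> 2 * n - 1"
  shows "g_b n j =
    (if j = 0 then 1
     else if j = 1 then real (Z (n - 1)) / real (Z n)
     else real (Z (n - 1)) / real (Z n) *
       (1 - g_b (n - 1) (j - 2)
        + (\<Sum>r = 0..n - 1. (- 1) ^ r * real ((n + 1) choose (r + 2)) * g (n - 1) r (j - 2))))"
proof -
  have j: "j < 2 * n" using assms by linarith
  have Zn: "g_b n j = paired_form n (starts_b n) {j} / real (Z n)"
    using g_b_eq[OF j] Z_pos[of n] by (simp add: field_simps)
  consider "j = 0" | "j = 1" | "j \<ge> 2" by linarith
  then show ?thesis
  proof cases
    case 1
    then show ?thesis using g_corner_relation[OF assms(1) j] by (simp add: g_def)
  next
    case 2
    have "paired_form n (starts_b n) {1} = real (Z (n - 1))"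
      unfolding Z_eq_paired_form starts_pred[OF assms(1)]
      by (rule paired_form_at_1[OF assms(1) starts_b_bounds(1)[OF assms(1)]])
    with 2 show ?thesis unfolding Zn by simp
  next
    case 3
    have n: "n - 1 \<ge> 1" "j - 2 < 2 * (n - 1)" using 3 j by auto
    let ?\<psi> = "paired_form (n - 1) (starts (n - 1))"
    have pairs: "pair_value ?\<psi> r (j - 2) = real (Z (n - 1)) * g (n - 1) r (j - 2)" if "r \<le> n - 1" for r
      using g_eq[of r "n - 1" "j - 2"] n that by simp
    have "paired_form n (starts_b n) {j} = pair_value ?\<psi> 0 (j - 2) +
        (\<Sum>r = 0..n - 1. (- 1) ^ r * real ((n + 1) choose (r + 2)) * pair_value ?\<psi> r (j - 2))"
      using paired_form_at_ge_2[OF assms(1) starts_b_bounds(1)[OF assms(1)] starts_b_bounds(2) 3 j]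
      by (simp only: starts_pred[OF assms(1)])
    also have "\<dots> = real (Z (n - 1)) * (g (n - 1) 0 (j - 2) +
        (\<Sum>r = 0..n - 1. (- 1) ^ r * real ((n + 1) choose (r + 2)) * g (n - 1) r (j - 2)))"
      unfolding distrib_left sum_distrib_left pairs[OF le0]
      by (intro arg_cong2[of _ _ _ _ "(+)"] sum.cong refl, subst pairs) auto
    also have "g (n - 1) 0 (j - 2) = 1 - g_b (n - 1) (j - 2)"
      by (rule g_corner_relation[OF n])
    finally show ?thesis using 3 by (simp add: Zn)
  qed
qed

end
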